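(* There exists an absolute constant $\gamma>0$ with the following property. For any $0<\delta\le 1$, any positive integer $N$, any $(\delta,N)$-focused homogeneous polynomial $f:\mathbb{R}^n\to\mathbb{R}$ of degree $m$, any $\epsilon>0$, and any positive integer $k\le n$ with $k\ge \gamma\,\epsilon^{-2}\delta^{-2}\ln(N+2)$, the inequality $$(1-\epsilon)^{m/2}\int_L f\,d\mu_k\;\le\;\left(\frac{k}{n}\right)^{m/2}\int_{\mathbb{R}^n} f\,d\mu_n\;\le\;(1-\epsilon)^{-m/2}\int_L f\,d\mu_k$$ holds with probability at least $2/3$ for a random $k$-dimensional subspace $L\subset\mathbb{R}^n$, chosen according to the Haar (rotation-invariant) probability measure on the Grassmannian $G_k(\mathbb{R}^n)$.
   Context: $\langle x,y\rangle=\sum_i \xi_i\eta_i$ is the standard scalar product on $\mathbb{R}^n$ and $\|x\|^2=\langle x,x\rangle$. $\mu_n$ is the standard Gaussian measure on $\mathbb{R}^n$ with density $(2\pi)^{-n/2}e^{-\|x\|^2/2}$. For a $k$-dimensional subspace $L\subset\mathbb{R}^n$, $\mu_k$ denotes the Gaussian measure on $L$ with density $(2\pi)^{-k/2}e^{-\|x\|^2/2}$, $x\in L$ (with respect to Lebesgue measure on $L$). Definition: for $0<\delta\le1$ and a positive integer $N$, a homogeneous polynomial $f:\mathbb{R}^n\to\mathbb{R}$ of degree $m$ is $(\delta,N)$-focused if there exist $N$ nonzero vectors $c_1,\dots,c_N\in\mathbb{R}^n$ such that for every pair $(i,j)$ the cosine of the angle between $c_i$ and $c_j$ is at least $\delta$,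 and $f(x)=\sum_I \alpha_I\prod_{i\in I}\langle c_i,x\rangle$, where the sum is over subsets $I\subset\{1,\dots,N\}$ with $|I|=m$ and all $\alpha_I\ge0$.
   Formalization: The formal theorem assumes 0 < ε < 1 instead of any ε > 0: for ε ≥ 1 the powers (1−ε)^{±m/2} are undefined for odd m (or for ε = 1), and the claim is false for example for m = 2, ε = 2, f = ξ_1², n = k. *)

theory Defs
  imports "HOL-Probability.Probability"
begin

text \<open>Vectors of R^n are represented as functions nat => real; only the
coordinates 0..n-1 matter (R^n is identified with functions vanishing from n on).\<close>

definition ip :: "nat \<Rightarrow> (nat \<Rightarrow> real) \<Rightarrow> (nat \<Rightarrow> real) \<Rightarrow> real" where
  "ip n x y = (\<Sum>i<n. x i * y i)"

definition vnorm :: "nat \<Rightarrow> (nat \<Rightarrow> real) \<Rightarrow> real" where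
  "vnorm n x = sqrt (ip n x x)"

definition Rn :: "nat \<Rightarrow> (nat \<Rightarrow> real) set" where
  "Rn n = {x. \<forall>i\<ge>n. x i = 0}"

definition gauss :: "nat \<Rightarrow> (nat \<Rightarrow> real) measure" where
  "gauss n = PiM {..<n} (\<lambda>_. density lborel std_normal_density)"

definition gauss_int :: "nat \<Rightarrow> ((nat \<Rightarrow> real) \<Rightarrow> real) \<Rightarrow> real" where
  "gauss_int n f = (\<integral>x. f (\<lambda>i. if i < n then x i else 0) \<partial>gauss n)"

definition focused :: "nat \<Rightarrow> real \<Rightarrow> nat \<Rightarrow> nat \<Rightarrow> ((nat \<Rightarrow> real) \<Rightarrow> real) \<Rightarrow> bool" where
  "focused n \<delta> N m f \<longleftrightarrow>
     (\<exists>c :: nat \<Rightarrow> nat \<Rightarrow> real. \<exists>\<alpha> :: nat set \<Rightarrow> real.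
        (\<forall>i\<in>{1..N}. c i \<in> Rn n \<and> c i \<noteq> (\<lambda>_. 0)) \<and>
        (\<forall>i\<in>{1..N}. \<forall>j\<in>{1..N}. ip n (c i) (c j) / (vnorm n (c i) * vnorm n (c j)) \<ge> \<delta>) \<and>
        (\<forall>I. I \<subseteq> {1..N} \<and> card I = m \<longrightarrow> \<alpha> I \<ge> 0) \<and>
        (\<forall>x\<in>Rn n. f x = (\<Sum>I\<in>{I. I \<subseteq> {1..N} \<and> card I = m}. \<alpha> I * (\<Prod>i\<in>I. ip n (c i) x))))"

definition span_n :: "nat \<Rightarrow> nat \<Rightarrow> (nat \<Rightarrow> nat \<Rightarrow> real) \<Rightarrow> (nat \<Rightarrow> real) set" where
  "span_n n k g = {(\<lambda>i. if i < n then (\<Sum>j<k. a j * g j i) else 0) | a. True}"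

definition is_onb :: "nat \<Rightarrow> nat \<Rightarrow> (nat \<Rightarrow> real) set \<Rightarrow> (nat \<Rightarrow> nat \<Rightarrow> real) \<Rightarrow> bool" where
  "is_onb n k L u \<longleftrightarrow> (\<forall>j<k. \<forall>l<k. ip n (u j) (u l) = (if j = l then 1 else 0))
      \<and> L = span_n n k u"

text \<open>Integral of f over L w.r.t. the standard Gaussian measure mu_k on L, computed via the
isometry R^k -> L given by an orthonormal basis of L (Lebesgue measure on L is by definition
transported along such an isometry).\<close>
definition gauss_int_sub :: "nat \<Rightarrow> nat \<Rightarrow> (nat \<Rightarrow> real) set \<Rightarrow> ((nat \<Rightarrow> real) \<Rightarrow> real) \<Rightarrow> real" where
  "gauss_int_sub n k L f =
     (let u = (SOME u. is_onb n k L u)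
      in \<integral>z. f (\<lambda>i. if i < n then (\<Sum>j<k. z j * u j i) else 0) \<partial>gauss k)"

text \<open>Haar (rotation-invariant) probability of an event P on the Grassmannian G_k(R^n):
the uniform random k-subspace is realised as the span of k independent standard Gaussian
vectors of R^n (whose distribution is the unique O(n)-invariant probability on G_k(R^n)).\<close>
definition haar_prob :: "nat \<Rightarrow> nat \<Rightarrow> ((nat \<Rightarrow> real) set \<Rightarrow> bool) \<Rightarrow> real" where
  "haar_prob n k P =
     measure (PiM {..<k} (\<lambda>_. gauss n))
       {g \<in> space (PiM {..<k} (\<lambda>_. gauss n)). P (span_n n k g)}"

end

theory Submission
  imports Defs
begin

text \<open>By Wick's formula the Gaussian integral of \<open>\<Prod>i\<in>I. \<langle>c i, x\<rangle>\<close> is a polynomial with nonnegative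
  coefficients, homogeneous of degree \<open>card I / 2\<close>, in the inner products \<open>\<langle>c i, c j\<rangle>\<close>. Restricting to \<open>L\<close>
  replaces them by \<open>\<langle>P c i, P c j\<rangle>\<close>, with \<open>P\<close> the orthogonal projection onto \<open>L\<close>. As the polynomial
  is focused, all \<open>\<langle>c i, c j\<rangle>\<close> are positive and bounded below, so it is enough that each
  \<open>n / k * \<langle>P c i, P c j\<rangle>\<close> equals \<open>\<langle>c i, c j\<rangle>\<close> up to an additive error \<open>\<epsilon> \<delta> \<parallel>c i\<parallel> \<parallel>c j\<parallel>\<close>. By polarisation this
  follows from a Johnson--Lindenstrauss estimate for the \<open>2 N\<^sup>2\<close> vectors \<open>c i / \<parallel>c i\<parallel> \<plusminus> c j / \<parallel>c j\<parallel>\<close>.\<close>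

section \<open>Orthonormal systems and the Gram--Schmidt process\<close>

text \<open>Two choices are hidden in the statement. \<open>gauss_int_sub\<close> evaluates the
  integral in a basis picked by \<open>SOME\<close>, of which neither a formula nor measurability is
  known. Wick's formula settles this: the integral depends on the projected vectors only through
  their Gram matrix, hence on the subspace alone, and the explicit Gram--Schmidt basis may replace
  the chosen one. \<open>haar_prob\<close> samples the subspace by Gaussian vectors; these are
  almost surely independent and their law is invariant under rotations, which reduces the
  Johnson--Lindenstrauss estimate to the concentration of two chi-square variables. The bound on
  \<open>k\<close> arises as follows: the accuracy \<open>\<epsilon> * \<delta>\<close> puts
  \<open>k * (\<epsilon> * \<delta>)\<^sup>2\<close> into the exponent of each failure probability,
  and the logarithm of \<open>N + 2\<close> pays for the union bound. A relative error in the Gram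
  entries is raised to the power \<open>m / 2\<close> because each term of Wick's formula is a
  product of \<open>m / 2\<close> entries.\<close>

lemma ip_commute: "ip n x y = ip n y x"
  by (simp add: ip_def mult.commute)

lemma ip_cong: "(\<And>i. i < n \<Longrightarrow> x i = x' i) \<Longrightarrow> (\<And>i. i < n \<Longrightarrow> y i = y' i) \<Longrightarrow> ip n x y = ip n x' y'"
  by (simp add: ip_def)

lemma ip_add_left: "ip n (\<lambda>i. x i + y i) z = ip n x z + ip n y z"
  by (simp add: ip_def distrib_right sum.distrib)

lemma ip_diff_left: "ip n (\<lambda>i. x i - y i) z = ip n x z - ip n y z"
  by (simp add: ip_def left_diff_distrib sum_subtractf)

lemma ip_scale_left: "ip n (\<lambda>i. a * x i) z = a * ip n x z"
  by (simp add: ip_def sum_distrib_left mult.assoc)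

lemma ip_divide_left: "ip n (\<lambda>i. x i / a) z = ip n x z / a"
  by (simp add: ip_def sum_divide_distrib)

lemma ip_sum_left: "ip n (\<lambda>i. \<Sum>l\<in>S. f l i) z = (\<Sum>l\<in>S. ip n (f l) z)"
  by (simp add: ip_def sum_distrib_right) (rule sum.swap)

lemmas ip_left = ip_add_left ip_diff_left ip_scale_left ip_divide_left ip_sum_left

lemma ip_add_right: "ip n z (\<lambda>i. x i + y i) = ip n z x + ip n z y"
  and ip_diff_right: "ip n z (\<lambda>i. x i - y i) = ip n z x - ip n z y"
  and ip_scale_right: "ip n z (\<lambda>i. a * x i) = a * ip n z x"
  and ip_divide_right: "ip n z (\<lambda>i. x i / a) = ip n z x / a"
  and ip_sum_right: "ip n z (\<lambda>i. \<Sum>l\<in>S. f l i) = (\<Sum>l\<in>S. ip n z (f l))"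
  by (simp_all only: ip_commute[of n z] ip_left)

lemmas ip_right = ip_add_right ip_diff_right ip_scale_right ip_divide_right ip_sum_right

lemma ip_self_nonneg: "ip n x x \<ge> 0"
  by (simp add: ip_def sum_nonneg)

lemma ip_self_eq_0_iff: "ip n x x = 0 \<longleftrightarrow> (\<forall>i<n. x i = 0)"
  by (simp add: ip_def sum_nonneg_eq_0_iff) auto

lemma vnorm_square: "(vnorm n x)\<^sup>2 = ip n x x"
  by (simp add: vnorm_def ip_self_nonneg)

lemma vnorm_eq_0_iff: "vnorm n x = 0 \<longleftrightarrow> (\<forall>i<n. x i = 0)"
  by (simp add: vnorm_def ip_self_eq_0_iff)

text \<open>Only coordinates below \<open>n\<close> are compared, whereas members of
  \<open>span_n\<close> are cut off there. So vectors that are not truncated, such as the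
  \<open>g j\<close> themselves, can be handled.\<close>

definition comb :: "nat \<Rightarrow> nat \<Rightarrow> (nat \<Rightarrow> nat \<Rightarrow> real) \<Rightarrow> (nat \<Rightarrow> real) \<Rightarrow> bool" where
  "comb n k g x \<longleftrightarrow> (\<exists>a. \<forall>i<n. x i = (\<Sum>l<k. a l * g l i))"

lemma comb_base: "j < k \<Longrightarrow> comb n k g (g j)"
  unfolding comb_def by (rule exI[of _ "\<lambda>l. if l = j then 1 else 0"]) (simp add: if_distrib[of "\<lambda>a. a * _"] cong: if_cong)

lemma comb_diff: "comb n k g x \<Longrightarrow> comb n k g y \<Longrightarrow> comb n k g (\<lambda>i. x i - y i)"
  unfolding comb_def
proof (elim exE)
  fix a b assume "\<forall>i<n. x i = (\<Sum>l<k. a l * g l i)" "\<forall>i<n. y i = (\<Sum>l<k. b l * g l i)"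
  then show "\<exists>a. \<forall>i<n. x i - y i = (\<Sum>l<k. a l * g l i)"
    by (intro exI[of _ "\<lambda>l. a l - b l"]) (simp add: left_diff_distrib sum_subtractf)
qed

lemma comb_scale: "comb n k g x \<Longrightarrow> comb n k g (\<lambda>i. b * x i)"
  unfolding comb_def
proof (elim exE)
  fix a assume "\<forall>i<n. x i = (\<Sum>l<k. a l * g l i)"
  then show "\<exists>a. \<forall>i<n. b * x i = (\<Sum>l<k. a l * g l i)"
    by (intro exI[of _ "\<lambda>l. b * a l"]) (simp add: sum_distrib_left mult.assoc)
qed

lemma comb_add: "comb n k g x \<Longrightarrow> comb n k g y \<Longrightarrow> comb n k g (\<lambda>i. x i + y i)"
  using comb_diff[of n k g x "\<lambda>i. - 1 * y i"] comb_scale[of n k g y "-1"] by simp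

lemma comb_0: "comb n k g (\<lambda>_. 0)"
  unfolding comb_def by (rule exI[of _ "\<lambda>_. 0"]) simp

lemma comb_sum: "(\<And>l. l \<in> S \<Longrightarrow> comb n k g (f l)) \<Longrightarrow> comb n k g (\<lambda>i. \<Sum>l\<in>S. f l i)"
  by (induction S rule: infinite_finite_induct) (auto intro: comb_0 comb_add)

lemma comb_cong: "comb n k g x \<Longrightarrow> (\<And>i. i < n \<Longrightarrow> x i = y i) \<Longrightarrow> comb n k g y"
  by (auto simp: comb_def)

lemma comb_trans:
  assumes "comb n k v x" and "\<And>l. l < k \<Longrightarrow> comb n k' w (v l)"
  shows "comb n k' w x"
proof -
  obtain a where a: "\<forall>i<n. x i = (\<Sum>l<k. a l * v l i)"
    using assms(1) by (auto simp: comb_def)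
  have "comb n k' w (\<lambda>i. \<Sum>l<k. a l * v l i)"
    by (intro comb_sum comb_scale assms(2)) simp
  then show ?thesis by (rule comb_cong) (simp add: a)
qed

lemma span_n_eq_comb: "span_n n k g = {x \<in> Rn n. comb n k g x}"
proof (intro equalityI subsetI)
  fix x assume "x \<in> span_n n k g"
  then show "x \<in> {x \<in> Rn n. comb n k g x}"
    by (auto simp: span_n_def Rn_def comb_def)
next
  fix x assume "x \<in> {x \<in> Rn n. comb n k g x}"
  then obtain a where "x \<in> Rn n" "\<forall>i<n. x i = (\<Sum>l<k. a l * g l i)"
    by (auto simp: comb_def)
  then show "x \<in> span_n n k g"
    by (auto simp: span_n_def Rn_def fun_eq_iff intro!: exI[of _ a])
qed

lemma span_n_eqD:
  assumes "span_n n k u = span_n n k v" "j < k"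
  shows "comb n k v (u j)"
proof -
  \<comment> \<open>\<open>u j\<close> may be nonzero from coordinate \<open>n\<close> on and then
    lies outside \<open>span_n\<close>; its truncation lies inside.\<close>
  let ?x = "\<lambda>i. if i < n then u j i else 0"
  have "?x \<in> span_n n k u"
    using comb_base[OF assms(2), of n u] unfolding span_n_eq_comb
    by (auto simp: Rn_def intro: comb_cong)
  then have "?x \<in> span_n n k v" using assms(1) by simp
  then have "comb n k v ?x" by (simp add: span_n_eq_comb)
  then show ?thesis by (rule comb_cong) simp
qed

text \<open>Gram--Schmidt on a linearly dependent family produces zero vectors, since division by
  \<open>0\<close> gives \<open>0\<close>; the following notion therefore admits zero vectors.\<close>

definition orthosys :: "nat \<Rightarrow> nat \<Rightarrow> (nat \<Rightarrow> nat \<Rightarrow> real) \<Rightarrow> bool" where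
  "orthosys n k v \<longleftrightarrow> (\<forall>j<k. \<forall>l<k. j \<noteq> l \<longrightarrow> ip n (v j) (v l) = 0) \<and>
     (\<forall>j<k. ip n (v j) (v j) \<in> {0, 1})"

lemma ip_eq_0_left: "ip n v v = 0 \<Longrightarrow> ip n v x = 0"
  by (simp add: ip_self_eq_0_iff) (simp add: ip_def)

text \<open>The coefficient of a zero vector in a combination is not determined, but its term
  vanishes either way.\<close>

lemma orthosys_expand:
  assumes "orthosys n k v" "comb n k v x" "i < n"
  shows "x i = (\<Sum>l<k. ip n x (v l) * v l i)"
proof -
  obtain a where a: "\<And>i. i < n \<Longrightarrow> x i = (\<Sum>l<k. a l * v l i)"
    using assms(2) by (auto simp: comb_def)
  have "ip n x (v l) * v l i = a l * v l i" if "l < k" for l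
  proof -
    have "ip n x (v l) = (\<Sum>j<k. a j * ip n (v j) (v l))"
      by (subst ip_cong[OF a refl]) (auto simp: ip_left)
    also have "\<dots> = (\<Sum>j<k. if j = l then a l * ip n (v l) (v l) else 0)"
      by (rule sum.cong) (use assms(1) that in \<open>auto simp: orthosys_def\<close>)
    also have "\<dots> = a l * ip n (v l) (v l)" using that by simp
    finally have *: "ip n x (v l) = a l * ip n (v l) (v l)" .
    have "ip n (v l) (v l) = 1 \<or> v l i = 0"
      using assms(1,3) that ip_self_eq_0_iff[of n "v l"] by (auto simp: orthosys_def)
    then show ?thesis using * by auto
  qed
  then show ?thesis using a[OF assms(3)] by (metis (no_types, lifting) lessThan_iff sum.cong)
qed

lemma orthosys_parseval:
  assumes "orthosys n k v" "comb n k v x"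
  shows "ip n x y = (\<Sum>l<k. ip n x (v l) * ip n (v l) y)"
  by (subst ip_cong[OF orthosys_expand[OF assms] refl]) (auto simp: ip_left)

text \<open>For an orthonormal \<open>v\<close> this is the inner product of the orthogonal
  projections of \<open>x\<close> and \<open>y\<close> onto the span of \<open>v\<close>. Zero
  vectors in an \<open>orthosys\<close> add nothing to it.\<close>

definition proj_ip :: "nat \<Rightarrow> nat \<Rightarrow> (nat \<Rightarrow> nat \<Rightarrow> real) \<Rightarrow> (nat \<Rightarrow> real) \<Rightarrow> (nat \<Rightarrow> real) \<Rightarrow> real" where
  "proj_ip n k v x y = (\<Sum>l<k. ip n (v l) x * ip n (v l) y)"

text \<open>A change of orthonormal basis: expand \<open>u j\<close> in \<open>v\<close>, exchange
  the sums, and collapse the expansion of \<open>v l\<close> in \<open>u\<close>.\<close>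

lemma proj_ip_span_eq:
  assumes u: "orthosys n k u" and v: "orthosys n k v"
    and span: "span_n n k u = span_n n k v"
  shows "proj_ip n k u x y = proj_ip n k v x y"
proof -
  have "proj_ip n k u x y = (\<Sum>j<k. (\<Sum>l<k. ip n (u j) (v l) * ip n (v l) x) * ip n (u j) y)"
    unfolding proj_ip_def
    by (intro sum.cong refl arg_cong2[where f = "(*)"] orthosys_parseval[OF v] span_n_eqD[OF span]) auto
  also have "\<dots> = (\<Sum>l<k. ip n (v l) x * (\<Sum>j<k. ip n (v l) (u j) * ip n (u j) y))"
    by (simp add: sum_distrib_left sum_distrib_right ip_commute[of n "u _" "v _"] mult_ac)
      (rule sum.swap)
  also have "\<dots> = proj_ip n k v x y"
    unfolding proj_ip_def
    by (intro sum.cong refl arg_cong2[where f = "(*)"] orthosys_parseval[OF u, symmetric]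
        span_n_eqD[OF span[symmetric]]) auto
  finally show ?thesis .
qed

lemma bessel:
  assumes "orthosys n k u"
  shows "proj_ip n k u x x \<le> ip n x x"
proof -
  let ?p = "\<lambda>i. \<Sum>l<k. ip n x (u l) * u l i"
  have *: "ip n (u l) ?p = ip n (u l) x" if "l < k" for l
  proof -
    have "ip n (u l) ?p = (\<Sum>j<k. if j = l then ip n x (u l) * ip n (u l) (u l) else 0)"
      unfolding ip_right using assms that by (intro sum.cong) (auto simp: orthosys_def)
    also have "\<dots> = ip n (u l) x"
      using assms that ip_eq_0_left[of n "u l" x] by (auto simp: orthosys_def ip_commute[of n x])
    finally show ?thesis .
  qed
  have p: "ip n x ?p = proj_ip n k u x x"
    by (simp add: ip_right proj_ip_def ip_commute[of n x])
  have pp: "ip n ?p ?p = proj_ip n k u x x"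
    unfolding ip_sum_left ip_scale_left proj_ip_def
    by (intro sum.cong refl) (simp add: *, simp add: ip_commute[of n x])
  have "0 \<le> ip n (\<lambda>i. x i - ?p i) (\<lambda>i. x i - ?p i)" by (rule ip_self_nonneg)
  also have "\<dots> = ip n x x - proj_ip n k u x x"
    by (simp only: ip_diff_left ip_diff_right p pp ip_commute[of n ?p x])
  finally show ?thesis by simp
qed

text \<open>Each sum counts the nonzero vectors of its system, that is, the dimension of the span.
  Parseval and Bessel compare the two counts without any dimension theory.\<close>

lemma orthosys_trace_le:
  assumes u: "orthosys n k u" and v: "orthosys n k v"
    and span: "span_n n k u = span_n n k v"
  shows "(\<Sum>j<k. ip n (u j) (u j)) \<le> (\<Sum>j<k. ip n (v j) (v j))"
proof -
  have "(\<Sum>j<k. ip n (u j) (u j)) = (\<Sum>j<k. \<Sum>l<k. ip n (u j) (v l) * ip n (v l) (u j))"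
    by (intro sum.cong refl orthosys_parseval[OF v] span_n_eqD[OF span]) auto
  also have "\<dots> = (\<Sum>l<k. proj_ip n k u (v l) (v l))"
    by (subst sum.swap) (simp add: proj_ip_def ip_commute[of n "v _" "u _"])
  also have "\<dots> \<le> (\<Sum>j<k. ip n (v j) (v j))"
    by (intro sum_mono bessel[OF u])
  finally show ?thesis .
qed

section \<open>Gram--Schmidt and linear independence\<close>

fun gs :: "nat \<Rightarrow> (nat \<Rightarrow> nat \<Rightarrow> real) \<Rightarrow> nat \<Rightarrow> nat \<Rightarrow> real" where
  "gs n g j = (let r = (\<lambda>i. g j i - (\<Sum>l<j. ip n (g j) (gs n g l) * gs n g l i))
     in (\<lambda>i. r i / vnorm n r))"

definition gres :: "nat \<Rightarrow> (nat \<Rightarrow> nat \<Rightarrow> real) \<Rightarrow> nat \<Rightarrow> nat \<Rightarrow> real" where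
  "gres n g j i = g j i - (\<Sum>l<j. ip n (g j) (gs n g l) * gs n g l i)"

declare gs.simps [simp del]

lemma gs_eq: "gs n g j = (\<lambda>i. gres n g j i / vnorm n (gres n g j))"
  by (subst gs.simps) (simp add: gres_def[abs_def] Let_def)

lemma gs_self: "ip n (gs n g j) (gs n g j) = (if vnorm n (gres n g j) = 0 then 0 else 1)"
  by (simp add: gs_eq[of n g j] ip_left ip_right vnorm_square[symmetric] power2_eq_square)

lemma gs_orth: "l < j \<Longrightarrow> ip n (gs n g j) (gs n g l) = 0"
proof (induction j arbitrary: l rule: less_induct)
  case (less j)
  have "ip n (gres n g j) (gs n g l) =
      ip n (g j) (gs n g l) - (\<Sum>l'<j. ip n (g j) (gs n g l') * ip n (gs n g l') (gs n g l))"
    by (simp add: gres_def[abs_def] ip_left)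
  also have "(\<Sum>l'<j. ip n (g j) (gs n g l') * ip n (gs n g l') (gs n g l)) =
      (\<Sum>l'<j. if l' = l then ip n (g j) (gs n g l) * ip n (gs n g l) (gs n g l) else 0)"
  proof (intro sum.cong refl)
    fix l' assume "l' \<in> {..<j}"
    then show "ip n (g j) (gs n g l') * ip n (gs n g l') (gs n g l) =
        (if l' = l then ip n (g j) (gs n g l) * ip n (gs n g l) (gs n g l) else 0)"
      using less.IH[of l' l] less.IH[of l l'] less.prems
      by (cases l' l rule: linorder_cases) (auto simp: ip_commute[of n "gs n g l" "gs n g l'"])
  qed
  also have "\<dots> = ip n (g j) (gs n g l) * ip n (gs n g l) (gs n g l)" using less.prems by simp
  \<comment> \<open>Either \<open>gs n g l\<close> has length 1, or it is zero and both sides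
    vanish.\<close>
  also have "\<dots> = ip n (g j) (gs n g l)"
    using gs_self[of n g l] ip_eq_0_left[of n "gs n g l" "g j"]
    by (auto simp: ip_commute[of n "g j"] split: if_splits)
  finally show ?case by (simp add: gs_eq[of n g j] ip_left)
qed

lemma orthosys_gs: "orthosys n k (gs n g)"
proof -
  have "ip n (gs n g j) (gs n g l) = 0" if "j \<noteq> l" for j l
    using that gs_orth[of l j n g] gs_orth[of j l n g]
    by (cases j l rule: linorder_cases) (auto simp: ip_commute[of n "gs n g j"])
  then show ?thesis by (simp add: orthosys_def gs_self)
qed

lemma span_gs: "span_n n k (gs n g) = span_n n k g"
proof -
  have 1: "comb n k g (gs n g j)" if "j < k" for j
    using that
  proof (induction j rule: less_induct)
    case (less j)
    have "comb n k g (\<lambda>i. inverse (vnorm n (gres n g j)) *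
        (g j i - (\<Sum>l<j. ip n (g j) (gs n g l) * gs n g l i)))"
      using less by (intro comb_scale comb_diff comb_sum comb_base) auto
    then show ?case by (rule comb_cong) (simp add: gs_eq[of n g j] gres_def field_simps)
  qed
  have 2: "comb n k (gs n g) (g j)" if "j < k" for j
  proof -
    have *: "comb n k (gs n g) (\<lambda>i. vnorm n (gres n g j) * gs n g j i +
        (\<Sum>l<j. ip n (g j) (gs n g l) * gs n g l i))"
      using that by (intro comb_add comb_scale comb_sum comb_base) auto
    \<comment> \<open>A residual of norm 0 vanishes below \<open>n\<close>, so the division by 0 in
      \<open>gs\<close> loses nothing.\<close>
    have "vnorm n (gres n g j) * gs n g j i = gres n g j i" if "i < n" for i
      using that vnorm_eq_0_iff[of n "gres n g j"] by (auto simp: gs_eq[of n g j])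
    then show ?thesis by (intro comb_cong[OF *]) (simp add: gres_def)
  qed
  show ?thesis using 1 2 by (auto simp: span_n_eq_comb intro: comb_trans)
qed

text \<open>Linear independence of the first \<open>k\<close> vectors, phrased by residuals: in this
  form it is measurable in \<open>g\<close>. It is equivalent to the existence of an orthonormal
  basis of the span with \<open>k\<close> vectors (\<open>is_onb_gs\<close>,
  \<open>is_onb_imp_indep\<close>).\<close>

definition indep :: "nat \<Rightarrow> nat \<Rightarrow> (nat \<Rightarrow> nat \<Rightarrow> real) \<Rightarrow> bool" where
  "indep n k g \<longleftrightarrow> (\<forall>j<k. vnorm n (gres n g j) \<noteq> 0)"

lemma is_onb_gs: "indep n k g \<Longrightarrow> is_onb n k (span_n n k g) (gs n g)"
  using orthosys_gs[of n k g] by (auto simp: is_onb_def orthosys_def indep_def span_gs gs_self)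

lemma is_onb_orthosys: "is_onb n k L u \<Longrightarrow> orthosys n k u"
  by (auto simp: is_onb_def orthosys_def)

text \<open>An orthonormal basis has \<open>k\<close> nonzero vectors, whereas a vanishing residual
  leaves fewer in the Gram--Schmidt system of the same span.\<close>

lemma is_onb_imp_indep:
  assumes "is_onb n k (span_n n k g) u"
  shows "indep n k g"
proof (rule ccontr)
  assume "\<not> indep n k g"
  then obtain j where j: "j < k" "ip n (gs n g j) (gs n g j) = 0"
    by (auto simp: indep_def gs_self)
  have "real k = (\<Sum>j<k. ip n (u j) (u j))" using assms by (simp add: is_onb_def)
  also have "\<dots> \<le> (\<Sum>j<k. ip n (gs n g j) (gs n g j))"
    using assms is_onb_orthosys[OF assms]
    by (intro orthosys_trace_le orthosys_gs) (auto simp: span_gs is_onb_def)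
  also have "\<dots> < (\<Sum>j<k. 1)"
    by (rule sum_strict_mono_ex1) (use j in \<open>auto simp: gs_self split: if_splits intro!: bexI[of _ j]\<close>)
  finally show False by simp
qed

lemma proj_ip_onb:
  assumes "is_onb n k (span_n n k g) u"
  shows "proj_ip n k u x y = proj_ip n k (gs n g) x y"
  using assms is_onb_orthosys[OF assms]
  by (intro proj_ip_span_eq orthosys_gs) (auto simp: span_gs is_onb_def)

section \<open>Wick's formula\<close>

interpretation std_normal: prob_space std_normal_distribution
  by (rule prob_space_normal_density) simp

interpretation gauss: product_sigma_finite "\<lambda>_::nat. std_normal_distribution"
  by standard

lemma prob_space_gauss: "prob_space (gauss n)"
  unfolding gauss_def by (intro prob_space_PiM prob_space_normal_density) simp

lemma sets_gauss [measurable_cong]: "sets (gauss n) = sets (PiM {..<n} (\<lambda>_. borel))"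
  unfolding gauss_def by (intro sets_PiM_cong) auto

lemma measurable_gauss_component [measurable]: "i < n \<Longrightarrow> (\<lambda>x. x i) \<in> borel_measurable (gauss n)"
  by (simp add: measurable_cong_sets[OF sets_gauss refl])

lemma measurable_ip [measurable]:
  assumes "\<And>i. i < n \<Longrightarrow> (\<lambda>x. f x i) \<in> borel_measurable M"
    and "\<And>i. i < n \<Longrightarrow> (\<lambda>x. g x i) \<in> borel_measurable M"
  shows "(\<lambda>x. ip n (f x) (g x)) \<in> borel_measurable M"
  unfolding ip_def using assms by (intro borel_measurable_sum borel_measurable_times) auto

lemma gauss_upd_measurable:
  assumes "l < n"
  shows "(\<lambda>(t, x). x(l := t)) \<in>
    std_normal_distribution \<Otimes>\<^sub>M PiM ({..<n} - {l}) (\<lambda>_. std_normal_distribution) \<rightarrow>\<^sub>M gauss n"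
proof -
  have "{..<n} = insert l ({..<n} - {l})" using assms by auto
  then show ?thesis unfolding gauss_def by (subst \<open>{..<n} = _\<close>) measurable
qed

lemma gauss_distr_upd:
  assumes "l < n"
  shows "distr (std_normal_distribution \<Otimes>\<^sub>M PiM ({..<n} - {l}) (\<lambda>_. std_normal_distribution))
    (gauss n) (\<lambda>(t, x). x(l := t)) = gauss n"
proof -
  have "insert l ({..<n} - {l}) = {..<n}" using assms by auto
  then show ?thesis
    using distr_pair_PiM_eq_PiM[of "{..<n} - {l}" "\<lambda>_. std_normal_distribution" l]
    by (simp add: gauss_def std_normal.prob_space_axioms)
qed

section \<open>Gaussian moments and integration by parts\<close>

lemma has_integral_std_normal_power:
  "has_bochner_integral std_normal_distribution (\<lambda>x. x ^ r)
     (if even r then fact r / (2 ^ (r div 2) * fact (r div 2)) else 0)"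
proof -
  have "has_bochner_integral lborel (\<lambda>x. std_normal_density x * x ^ r)
      (if even r then fact r / (2 ^ (r div 2) * fact (r div 2)) else 0)"
    using std_normal_moment_even[of "r div 2"] std_normal_moment_odd[of "r div 2"]
    by (cases "even r") auto
  then show ?thesis
    by (intro has_bochner_integral_density) auto
qed

lemma integrable_std_normal_power [simp]: "integrable std_normal_distribution (\<lambda>x. x ^ r)"
  using has_integral_std_normal_power by (rule integrable.intros)

text \<open>Integration by parts for a monomial, read off from the known moments. At
  \<open>r = 0\<close> the truncated difference \<open>r - 1\<close> is multiplied by 0.\<close>

lemma integral_std_normal_power_Suc:
  "(LINT x|std_normal_distribution. x ^ Suc r) = real r * (LINT x|std_normal_distribution. x ^ (r - 1))"
proof (cases r)
  case (Suc q)
  show ?thesis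
  proof (cases "even q")
    case True
    then obtain s where s: "q = 2 * s" by (elim evenE)
    have "(fact (2 * Suc s) :: real) = 2 * (real s + 1) * (2 * real s + 1) * fact (2 * s)"
      by (simp add: algebra_simps)
    moreover have "(fact (Suc s) :: real) = (real s + 1) * fact s"
      by (simp add: algebra_simps)
    moreover have r: "Suc r = 2 * Suc s" "r - 1 = 2 * s" "real r = 2 * real s + 1"
      using Suc s by simp_all
    ultimately show ?thesis
      unfolding r by (simp add: has_bochner_integral_integral_eq[OF has_integral_std_normal_power]
          del: power_Suc fact_Suc mult_Suc_right) (simp add: divide_simps)
  qed (use Suc in \<open>simp add: has_bochner_integral_integral_eq[OF has_integral_std_normal_power] del: power_Suc\<close>)
qed (use has_bochner_integral_integral_eq[OF has_integral_std_normal_power[of 1]] in simp)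

lemma integrable_std_normal_poly [simp]: "integrable std_normal_distribution (poly p)"
  unfolding poly_altdef by (intro Bochner_Integration.integrable_sum integrable_mult_right) simp

text \<open>Stein's identity. Going through the moments by linearity avoids boundary terms at
  infinity.\<close>

lemma std_normal_integration_by_parts:
  "(LINT t|std_normal_distribution. t * poly p t) = (LINT t|std_normal_distribution. poly (pderiv p) t)"
proof -
  let ?N = "std_normal_distribution"
  have "(LINT t|?N. t * poly p t) = (LINT t|?N. (\<Sum>i\<le>degree p. coeff p i * t ^ Suc i))"
    by (simp add: poly_altdef sum_distrib_left mult_ac)
  also have "\<dots> = (\<Sum>i\<le>degree p. coeff p i * (LINT t|?N. t ^ Suc i))"
    by (subst Bochner_Integration.integral_sum) (auto simp del: power_Suc)
  also have "\<dots> = (\<Sum>i\<le>degree p. LINT t|?N. (real i * coeff p i) * t ^ (i - 1))"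
    unfolding integral_std_normal_power_Suc by (simp add: mult_ac)
  also have "\<dots> = (LINT t|?N. (\<Sum>i\<le>degree p. (real i * coeff p i) * t ^ (i - 1)))"
    by (subst Bochner_Integration.integral_sum) (auto simp del: power_Suc)
  also have "\<dots> = (LINT t|?N. poly (pderiv p) t)"
  proof -
    have "pderiv p = (\<Sum>i\<le>degree p. monom (real i * coeff p i) (i - 1))"
      by (subst poly_as_sum_of_monoms[of p, symmetric]) (simp add: higher_pderiv_sum[of 1, simplified] pderiv_monom)
    then show ?thesis by (simp add: poly_sum poly_monom)
  qed
  finally show ?thesis .
qed

text \<open>Stein's identity with the product rule. Affine factors are what the inner products
  \<open>ip n (v j) x\<close> become when all coordinates of \<open>x\<close> but one are
  frozen.\<close>

lemma std_normal_integral_prod_affine: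
  assumes "finite J"
  shows "(LINT t|std_normal_distribution. t * (\<Prod>j\<in>J. a j + b j * t)) =
    (\<Sum>j\<in>J. b j * (LINT t|std_normal_distribution. (\<Prod>i\<in>J-{j}. a i + b i * t)))"
proof -
  let ?N = "std_normal_distribution" and ?p = "\<lambda>j. [:a j, b j:]"
  have *: "(\<Prod>j\<in>K. a j + b j * t) = poly (\<Prod>j\<in>K. ?p j) t" for K t
    by (simp add: poly_prod mult.commute)
  have "(LINT t|?N. t * (\<Prod>j\<in>J. a j + b j * t)) = (LINT t|?N. poly (pderiv (\<Prod>j\<in>J. ?p j)) t)"
    unfolding * by (rule std_normal_integration_by_parts)
  also have "\<dots> = (LINT t|?N. (\<Sum>j\<in>J. b j * poly (\<Prod>i\<in>J-{j}. ?p i) t))"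
    by (simp add: pderiv_prod pderiv_pCons poly_sum mult.commute)
  also have "\<dots> = (\<Sum>j\<in>J. b j * (LINT t|?N. poly (\<Prod>i\<in>J-{j}. ?p i) t))"
    by (subst Bochner_Integration.integral_sum) auto
  finally show ?thesis unfolding * .
qed

text \<open>The monomial strengthens the induction: expanding one more inner product multiplies it
  by some \<open>x l\<close>.\<close>

lemma integrable_gauss_prod_ip:
  assumes "finite J"
  shows "integrable (gauss n) (\<lambda>x. (\<Prod>l<n. x l ^ r l) * (\<Prod>j\<in>J. ip n (v j) x))"
  using assms
proof (induction J arbitrary: r rule: finite_induct)
  case empty
  have "integrable (gauss n) (\<lambda>x. \<Prod>l<n. x l ^ r l)"
    unfolding gauss_def by (rule gauss.product_integrable_prod) auto
  then show ?case by simp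
next
  case (insert j J)
  have "integrable (gauss n) (\<lambda>x. \<Sum>l<n. v j l *
      ((\<Prod>l'<n. x l' ^ (r(l := Suc (r l))) l') * (\<Prod>j\<in>J. ip n (v j) x)))"
    by (intro Bochner_Integration.integrable_sum integrable_mult_right insert.IH)
  moreover have "(\<Sum>l<n. v j l * ((\<Prod>l'<n. x l' ^ (r(l := Suc (r l))) l') * (\<Prod>j\<in>J. ip n (v j) x))) =
      (\<Prod>l<n. x l ^ r l) * (\<Prod>j\<in>insert j J. ip n (v j) x)" (is "?L x = ?R x") for x :: "nat \<Rightarrow> real"
  proof -
    have "(\<Prod>l'<n. x l' ^ (r(l := Suc (r l))) l') = x l * (\<Prod>l'<n. x l' ^ r l')" if "l < n" for l
      using that by (subst (1 2) prod.remove[of _ l]) auto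
    then have "?L x = (\<Sum>l<n. (v j l * x l) * ((\<Prod>l'<n. x l' ^ r l') * (\<Prod>j\<in>J. ip n (v j) x)))"
      by (intro sum.cong) auto
    also have "\<dots> = ?R x"
      using insert.hyps unfolding sum_distrib_right[symmetric] by (simp add: ip_def[of n "v j"])
    finally show ?thesis .
  qed
  ultimately show ?case by simp
qed

lemma integrable_gauss_prod_ip' [simp]:
  "finite J \<Longrightarrow> integrable (gauss n) (\<lambda>x. \<Prod>j\<in>J. ip n (v j) x)"
  using integrable_gauss_prod_ip[of J n "\<lambda>_. 0" v] by simp

lemma integrable_gauss_coord_prod_ip:
  assumes "finite J" "l < n"
  shows "integrable (gauss n) (\<lambda>x. x l * (\<Prod>j\<in>J. ip n (v j) x))"
proof -
  have "(\<Prod>l'<n. x l' ^ (if l' = l then 1 else 0)) = x l" for x :: "nat \<Rightarrow> real"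
    using assms(2) by (simp add: if_distrib[of "\<lambda>e. _ ^ e"] cong: if_cong)
  then show ?thesis using integrable_gauss_prod_ip[OF assms(1), of n "\<lambda>l'. if l' = l then 1 else 0" v] by simp
qed

text \<open>Fubini isolates coordinate \<open>l\<close>, in which the factors are affine with slopes
  \<open>v j l\<close>.\<close>

lemma gauss_integration_by_parts:
  assumes "finite J" "l < n"
  shows "(LINT x|gauss n. x l * (\<Prod>j\<in>J. ip n (v j) x)) =
    (\<Sum>j\<in>J. v j l * (LINT x|gauss n. (\<Prod>i\<in>J-{j}. ip n (v i) x)))"
proof -
  let ?N = "std_normal_distribution"
  let ?G = "PiM ({..<n} - {l}) (\<lambda>_. ?N)"
  interpret P: pair_sigma_finite ?N ?G
    by (intro pair_sigma_finite.intro gauss.sigma_finite) (auto intro: std_normal.sigma_finite_measure_axioms)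
  have int: "integrable (?N \<Otimes>\<^sub>M ?G) (\<lambda>(t, x). f (x(l := t)))"
    and gauss: "(LINT x|gauss n. f x) = (LINT (t, x)|(?N \<Otimes>\<^sub>M ?G). f (x(l := t)))"
    if "integrable (gauss n) f" for f :: "_ \<Rightarrow> real"
    using integrable_distr_eq[OF gauss_upd_measurable[OF assms(2)], of f, unfolded gauss_distr_upd[OF assms(2)]]
      integral_distr[OF gauss_upd_measurable[OF assms(2)], of f, unfolded gauss_distr_upd[OF assms(2)]] that
    by (auto simp: case_prod_unfold)
  have gauss_l: "(LINT x|gauss n. f x) = (LINT x|?G. LINT t|?N. f (x(l:=t)))"
    if "integrable (gauss n) f" for f :: "_ \<Rightarrow> real"
    using P.integral_snd[OF int[OF that]] gauss[OF that] by simp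
  have int_l: "integrable ?G (\<lambda>x. LINT t|?N. f (x(l:=t)))"
    if "integrable (gauss n) f" for f :: "_ \<Rightarrow> real"
    using P.integrable_snd[OF int[OF that]] by simp
  have ins: "{..<n} = insert l ({..<n} - {l})" using assms(2) by auto
  have ip_upd: "ip n (v j) (x(l := t)) = (\<Sum>i\<in>({..<n} - {l}). v j i * x i) + v j l * t" for j x t
    unfolding ip_def by (subst ins, subst sum.insert) auto
  have "(LINT x|gauss n. x l * (\<Prod>j\<in>J. ip n (v j) x)) =
      (LINT x|?G. LINT t|?N. t * (\<Prod>j\<in>J. (\<Sum>i\<in>({..<n} - {l}). v j i * x i) + v j l * t))"
    by (subst gauss_l[OF integrable_gauss_coord_prod_ip[OF assms]]) (simp add: ip_upd)
  also have "\<dots> = (LINT x|?G. (\<Sum>j\<in>J. v j l * (LINT t|?N. (\<Prod>i\<in>J-{j}. ip n (v i) (x(l := t))))))"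
    unfolding ip_upd by (subst std_normal_integral_prod_affine[OF assms(1)]) simp
  also have "\<dots> = (\<Sum>j\<in>J. v j l * (LINT x|?G. LINT t|?N. (\<Prod>i\<in>J-{j}. ip n (v i) (x(l := t)))))"
    by (subst Bochner_Integration.integral_sum) (use assms in \<open>auto intro!: integrable_mult_right int_l\<close>)
  also have "\<dots> = (\<Sum>j\<in>J. v j l * (LINT x|gauss n. (\<Prod>i\<in>J-{j}. ip n (v i) x)))"
    by (subst gauss_l) (use assms in auto)
  finally show ?thesis .
qed

text \<open>The recursive form of Wick's (Isserlis') formula: factor \<open>i\<close> is paired with
  each \<open>j\<close> in turn. Inductions along it replace the enumeration of perfect
  matchings.\<close>

theorem wick_recursion:
  assumes "finite J" "i \<notin> J"
  shows "(LINT x|gauss n. (\<Prod>j\<in>insert i J. ip n (v j) x)) =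
    (\<Sum>j\<in>J. ip n (v i) (v j) * (LINT x|gauss n. (\<Prod>l\<in>J-{j}. ip n (v l) x)))"
proof -
  have "(LINT x|gauss n. (\<Prod>j\<in>insert i J. ip n (v j) x)) =
      (LINT x|gauss n. (\<Sum>l<n. v i l * (x l * (\<Prod>j\<in>J. ip n (v j) x))))"
    using assms by (simp add: ip_def[of n "v i"] sum_distrib_right mult.assoc)
  also have "\<dots> = (\<Sum>l<n. v i l * (LINT x|gauss n. x l * (\<Prod>j\<in>J. ip n (v j) x)))"
    by (subst Bochner_Integration.integral_sum)
      (use assms in \<open>auto intro!: integrable_mult_right integrable_gauss_coord_prod_ip\<close>)
  also have "\<dots> = (\<Sum>l<n. \<Sum>j\<in>J. v i l * v j l * (LINT x|gauss n. (\<Prod>l\<in>J-{j}. ip n (v l) x)))"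
    by (simp add: gauss_integration_by_parts[OF assms(1)] sum_distrib_left mult_ac)
  also have "\<dots> = (\<Sum>j\<in>J. ip n (v i) (v j) * (LINT x|gauss n. (\<Prod>l\<in>J-{j}. ip n (v l) x)))"
    by (subst sum.swap) (simp add: ip_def sum_distrib_right)
  finally show ?thesis .
qed

text \<open>The recursion sees the vectors only through their inner products. This is what permits
  exchanging the orthonormal basis of a subspace.\<close>

lemma wick_gram_cong:
  assumes "finite I"
    and "\<And>i j. i \<in> I \<Longrightarrow> j \<in> I \<Longrightarrow> ip n (v i) (v j) = ip k (w i) (w j)"
  shows "(LINT x|gauss n. (\<Prod>j\<in>I. ip n (v j) x)) = (LINT x|gauss k. (\<Prod>j\<in>I. ip k (w j) x))"
  using assms
proof (induction I rule: finite_psubset_induct)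
  case (psubset I)
  show ?case
  proof (cases "I = {}")
    case True
    then show ?thesis
      using prob_space.prob_space[OF prob_space_gauss] by simp
  next
    case False
    then obtain i where i: "i \<in> I" by auto
    have "(LINT x|gauss n. (\<Prod>l\<in>I - {i} - {j}. ip n (v l) x)) =
        (LINT x|gauss k. (\<Prod>l\<in>I - {i} - {j}. ip k (w l) x))" for j
      using i psubset.prems by (intro psubset.IH) auto
    then show ?thesis
      using wick_recursion[of "I - {i}" i n v] wick_recursion[of "I - {i}" i k w]
        psubset.hyps psubset.prems i by (auto simp: insert_absorb intro!: sum.cong)
  qed
qed

text \<open>The recursion removes two factors at a time and ends at a single factor, which has no
  partner left.\<close>

lemma wick_odd:
  assumes "finite I" "odd (card I)"
  shows "(LINT x|gauss n. (\<Prod>j\<in>I. ip n (v j) x)) = 0"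
  using assms
proof (induction I rule: finite_psubset_induct)
  case (psubset I)
  then obtain i where i: "i \<in> I" by fastforce
  have "(LINT x|gauss n. (\<Prod>l\<in>I - {i} - {j}. ip n (v l) x)) = 0" if "j \<in> I - {i}" for j
  proof (rule psubset.IH)
    have "{i, j} \<subseteq> I" "card {i, j} = 2" using i that by auto
    then have "card I \<ge> 2" "card (I - {i, j}) = card I - 2"
      using psubset.hyps by (metis card_mono, metis card_Diff_subset finite_subset)
    moreover have "I - {i} - {j} = I - {i, j}" by auto
    ultimately show "odd (card (I - {i} - {j}))" using psubset.prems by simp
  qed (use i in auto)
  then show ?case
    using wick_recursion[of "I - {i}" i n v] psubset.hyps i by (simp add: insert_absorb)
qed

lemma wick_nonneg:
  assumes "finite I" and "\<And>i j. i \<in> I \<Longrightarrow> j \<in> I \<Longrightarrow> ip n (v i) (v j) \<ge> 0"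
  shows "(LINT x|gauss n. (\<Prod>j\<in>I. ip n (v j) x)) \<ge> 0"
  using assms
proof (induction I rule: finite_psubset_induct)
  case (psubset I)
  show ?case
  proof (cases "I = {}")
    case False
    then obtain i where i: "i \<in> I" by auto
    have "(LINT x|gauss n. (\<Prod>l\<in>I - {i} - {j}. ip n (v l) x)) \<ge> 0" for j
      using i psubset.prems by (intro psubset.IH) auto
    then show ?thesis
      using wick_recursion[of "I - {i}" i n v] psubset.hyps psubset.prems i
      by (auto simp: insert_absorb intro!: sum_nonneg mult_nonneg_nonneg)
  qed simp
qed

text \<open>Every complete pairing contributes \<open>card I div 2\<close> inner products, each of
  which absorbs one factor \<open>s\<close> or \<open>t\<close>; nonnegativity lets the inequalities
  be multiplied. The lemma serves both directions of the comparison between the full space and the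
  subspace.\<close>

lemma wick_mono:
  assumes "finite I" "even (card I)" "s \<ge> 0" "t \<ge> 0"
    and "\<And>i j. i \<in> I \<Longrightarrow> j \<in> I \<Longrightarrow> ip n (v i) (v j) \<ge> 0"
    and "\<And>i j. i \<in> I \<Longrightarrow> j \<in> I \<Longrightarrow> ip k (w i) (w j) \<ge> 0"
    and "\<And>i j. i \<in> I \<Longrightarrow> j \<in> I \<Longrightarrow> s * ip n (v i) (v j) \<le> t * ip k (w i) (w j)"
  shows "s ^ (card I div 2) * (LINT x|gauss n. (\<Prod>j\<in>I. ip n (v j) x)) \<le>
    t ^ (card I div 2) * (LINT x|gauss k. (\<Prod>j\<in>I. ip k (w j) x))"
  using assms(1,2,5-7)
proof (induction I rule: finite_psubset_induct)
  case (psubset I)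
  show ?case
  proof (cases "I = {}")
    case True
    then show ?thesis
      using prob_space.prob_space[OF prob_space_gauss] by simp
  next
    case False
    then obtain i where i: "i \<in> I" by auto
    obtain c where c: "card I = Suc (Suc c)"
      using psubset.prems(1) psubset.hyps False by (cases "card I"; cases "card I - 1") auto
    let ?V = "\<lambda>j. LINT x|gauss n. (\<Prod>l\<in>I - {i} - {j}. ip n (v l) x)"
    let ?W = "\<lambda>j. LINT x|gauss k. (\<Prod>l\<in>I - {i} - {j}. ip k (w l) x)"
    have "s ^ (card I div 2) * (ip n (v i) (v j) * ?V j) \<le> t ^ (card I div 2) * (ip k (w i) (w j) * ?W j)"
      if j: "j \<in> I - {i}" for j
    proof -
      have card: "card (I - {i} - {j}) = c"
        using i j c psubset.hyps by (simp add: card_Diff_singleton)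
      have IH: "s ^ (c div 2) * ?V j \<le> t ^ (c div 2) * ?W j"
        using psubset.IH[of "I - {i} - {j}"] i psubset.prems c unfolding card by auto
      have "(s * ip n (v i) (v j)) * (s ^ (c div 2) * ?V j) \<le>
          (t * ip k (w i) (w j)) * (t ^ (c div 2) * ?W j)"
        using i j psubset.prems psubset.hyps assms(3,4)
        by (intro mult_mono IH psubset.prems mult_nonneg_nonneg zero_le_power wick_nonneg) auto
      then show ?thesis by (simp add: c mult_ac)
    qed
    then have "(\<Sum>j\<in>I-{i}. s ^ (card I div 2) * (ip n (v i) (v j) * ?V j)) \<le>
        (\<Sum>j\<in>I-{i}. t ^ (card I div 2) * (ip k (w i) (w j) * ?W j))"
      by (rule sum_mono)
    then show ?thesis
      using wick_recursion[of "I - {i}" i n v] wick_recursion[of "I - {i}" i k w] psubset.hyps i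
      by (simp add: insert_absorb sum_distrib_left)
  qed
qed

section \<open>Rotation invariance\<close>

text \<open>Fubini reduces the rotation to two affine substitutions in one variable, whose Jacobians
  \<open>\<bar>1 / c\<bar>\<close> and \<open>\<bar>c\<bar>\<close> cancel. For \<open>c = 0\<close>
  the rotation exchanges the axes up to signs and is treated apart.\<close>

lemma nn_integral_rotation_lborel:
  fixes f :: "real \<times> real \<Rightarrow> ennreal"
  assumes [measurable]: "f \<in> borel_measurable borel" and cs: "c\<^sup>2 + s\<^sup>2 = 1"
  shows "(\<integral>\<^sup>+y. \<integral>\<^sup>+z. f (c * y + s * z, c * z - s * y) \<partial>lborel \<partial>lborel) =
    (\<integral>\<^sup>+y. \<integral>\<^sup>+z. f (y, z) \<partial>lborel \<partial>lborel)"
proof -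
  have [measurable]: "f \<in> borel_measurable (borel \<Otimes>\<^sub>M borel)" by (simp add: borel_prod)
  show ?thesis
  proof (cases "c = 0")
    case True
    then have s: "s * s = 1" "\<bar>s\<bar> = 1" "s \<noteq> 0" using cs by (auto simp: power2_eq_square abs_if square_eq_1_iff)
    have "(\<integral>\<^sup>+y. \<integral>\<^sup>+z. f (c * y + s * z, c * z - s * y) \<partial>lborel \<partial>lborel) =
        (\<integral>\<^sup>+y. \<integral>\<^sup>+a. f (a, - s * y) \<partial>lborel \<partial>lborel)"
      using s True by (subst (2) nn_integral_real_affine[where c = s and t = 0]) (auto simp: mult.assoc[symmetric])
    also have "\<dots> = (\<integral>\<^sup>+a. \<integral>\<^sup>+y. f (a, - s * y) \<partial>lborel \<partial>lborel)"
      by (rule lborel_pair.Fubini') measurable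
    also have "\<dots> = (\<integral>\<^sup>+a. \<integral>\<^sup>+b. f (a, b) \<partial>lborel \<partial>lborel)"
      using s by (subst (4) nn_integral_real_affine[where c = "- s" and t = 0]) auto
    finally show ?thesis .
  next
    case False
    \<comment> \<open>Taking the first rotated coordinate \<open>a\<close> as new variable means
      \<open>y = (a - s * z) / c\<close>; the second rotated coordinate is then affine in
      \<open>z\<close>.\<close>
    have eq: "c * z - s * (- (s * z / c) + 1 / c * a) = (z - s * a) / c" for a z
    proof -
      have "c * (c * z - s * (- (s * z / c) + 1 / c * a)) = (c\<^sup>2 + s\<^sup>2) * z - s * a"
        using False by (simp add: algebra_simps power2_eq_square)
      then have "c * z - s * (- (s * z / c) + 1 / c * a) = ((c\<^sup>2 + s\<^sup>2) * z - s * a) / c"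
        using False by (metis nonzero_mult_div_cancel_left)
      then show ?thesis using cs by simp
    qed
    have id: "c * (- (s * z / c) + 1 / c * a) + s * z = a" for a z
      using False by (simp add: field_simps)
    have "(\<integral>\<^sup>+y. \<integral>\<^sup>+z. f (c * y + s * z, c * z - s * y) \<partial>lborel \<partial>lborel) =
        (\<integral>\<^sup>+z. \<integral>\<^sup>+y. f (c * y + s * z, c * z - s * y) \<partial>lborel \<partial>lborel)"
      by (rule lborel_pair.Fubini') measurable
    also have "\<dots> = (\<integral>\<^sup>+z. \<bar>1 / c\<bar> * (\<integral>\<^sup>+a. f (a, (z - s * a) / c) \<partial>lborel) \<partial>lborel)"
    proof (intro nn_integral_cong)
      fix z
      have "(\<integral>\<^sup>+y. f (c * y + s * z, c * z - s * y) \<partial>lborel) = \<bar>1 / c\<bar> * (\<integral>\<^sup>+a.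
          f (c * (- (s * z / c) + 1 / c * a) + s * z, c * z - s * (- (s * z / c) + 1 / c * a)) \<partial>lborel)"
        using False by (intro nn_integral_real_affine) auto
      then show "(\<integral>\<^sup>+y. f (c * y + s * z, c * z - s * y) \<partial>lborel) =
          \<bar>1 / c\<bar> * (\<integral>\<^sup>+a. f (a, (z - s * a) / c) \<partial>lborel)"
        by (simp only: eq id)
    qed
    also have "\<dots> = \<bar>1 / c\<bar> * (\<integral>\<^sup>+z. \<integral>\<^sup>+a. f (a, (z - s * a) / c) \<partial>lborel \<partial>lborel)"
      by (rule nn_integral_cmult) measurable
    also have "(\<integral>\<^sup>+z. \<integral>\<^sup>+a. f (a, (z - s * a) / c) \<partial>lborel \<partial>lborel) =
        (\<integral>\<^sup>+a. \<integral>\<^sup>+z. f (a, (z - s * a) / c) \<partial>lborel \<partial>lborel)"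
      by (rule lborel_pair.Fubini') measurable
    also have "\<dots> = (\<integral>\<^sup>+a. \<bar>c\<bar> * (\<integral>\<^sup>+b. f (a, b) \<partial>lborel) \<partial>lborel)"
    proof (intro nn_integral_cong)
      fix a
      show "(\<integral>\<^sup>+z. f (a, (z - s * a) / c) \<partial>lborel) = \<bar>c\<bar> * (\<integral>\<^sup>+b. f (a, b) \<partial>lborel)"
        using False by (subst nn_integral_real_affine[where c = c and t = "s * a"]) auto
    qed
    also have "\<dots> = \<bar>c\<bar> * (\<integral>\<^sup>+a. \<integral>\<^sup>+b. f (a, b) \<partial>lborel \<partial>lborel)"
      by (rule nn_integral_cmult) measurable
    finally show ?thesis
      using False by (simp add: mult.assoc[symmetric] ennreal_mult[symmetric])
  qed
qed

text \<open>The joint density depends on \<open>y\<^sup>2 + z\<^sup>2\<close> only, so invariance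
  carries over from Lebesgue measure.\<close>

lemma nn_integral_rotation_std_normal:
  fixes f :: "real \<times> real \<Rightarrow> ennreal"
  assumes [measurable]: "f \<in> borel_measurable borel" and cs: "c\<^sup>2 + s\<^sup>2 = 1"
  shows "(\<integral>\<^sup>+y. \<integral>\<^sup>+z. f (c * y + s * z, c * z - s * y) \<partial>std_normal_distribution \<partial>std_normal_distribution) =
    (\<integral>\<^sup>+y. \<integral>\<^sup>+z. f (y, z) \<partial>std_normal_distribution \<partial>std_normal_distribution)"
proof -
  let ?\<phi> = "std_normal_density"
  let ?F = "\<lambda>p. ennreal (?\<phi> (fst p) * ?\<phi> (snd p)) * f p"
  have [measurable]: "f \<in> borel_measurable (borel \<Otimes>\<^sub>M borel)" by (simp add: borel_prod)
  have density: "(\<integral>\<^sup>+y. \<integral>\<^sup>+z. g (y, z) \<partial>std_normal_distribution \<partial>std_normal_distribution) =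
      (\<integral>\<^sup>+y. \<integral>\<^sup>+z. ennreal (?\<phi> y * ?\<phi> z) * g (y, z) \<partial>lborel \<partial>lborel)"
    if [measurable]: "g \<in> borel_measurable (borel \<Otimes>\<^sub>M borel)" for g
    by (simp add: nn_integral_density nn_integral_cmult[symmetric] ennreal_mult mult.assoc)
  have rot: "?\<phi> y * ?\<phi> z = ?\<phi> (c * y + s * z) * ?\<phi> (c * z - s * y)" for y z
  proof -
    have "(c * y + s * z)\<^sup>2 + (c * z - s * y)\<^sup>2 = (c\<^sup>2 + s\<^sup>2) * (y\<^sup>2 + z\<^sup>2)"
      by (simp add: power2_eq_square algebra_simps)
    then have "- y\<^sup>2 / 2 + - z\<^sup>2 / 2 = - (c * y + s * z)\<^sup>2 / 2 + - (c * z - s * y)\<^sup>2 / 2"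
      unfolding cs by simp
    then show ?thesis
      by (simp add: std_normal_density_def mult_exp_exp)
  qed
  have "(\<integral>\<^sup>+y. \<integral>\<^sup>+z. f (c * y + s * z, c * z - s * y) \<partial>std_normal_distribution \<partial>std_normal_distribution) =
      (\<integral>\<^sup>+y. \<integral>\<^sup>+z. ?F (c * y + s * z, c * z - s * y) \<partial>lborel \<partial>lborel)"
    using density[of "\<lambda>(y, z). f (c * y + s * z, c * z - s * y)"] by (simp add: rot[symmetric])
  also have "\<dots> = (\<integral>\<^sup>+y. \<integral>\<^sup>+z. ?F (y, z) \<partial>lborel \<partial>lborel)"
    by (rule nn_integral_rotation_lborel[OF _ cs]) (simp add: borel_prod[symmetric])
  also have "\<dots> = (\<integral>\<^sup>+y. \<integral>\<^sup>+z. f (y, z) \<partial>std_normal_distribution \<partial>std_normal_distribution)"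
    by (subst density) auto
  finally show ?thesis .
qed

text \<open>A Givens rotation in the plane of coordinates \<open>p\<close> and \<open>q\<close>.
  These rotations can stand in for the orthogonal group, since they suffice to move any vector onto
  the axis of coordinate 0.\<close>

definition rot :: "nat \<Rightarrow> nat \<Rightarrow> real \<Rightarrow> real \<Rightarrow> (nat \<Rightarrow> real) \<Rightarrow> nat \<Rightarrow> real" where
  "rot p q c s x = x(p := c * x p + s * x q, q := c * x q - s * x p)"

lemma measurable_rot [measurable]:
  assumes "p < n" "q < n" shows "rot p q c s \<in> gauss n \<rightarrow>\<^sub>M gauss n"
proof -
  have "rot p q c s \<in> gauss n \<rightarrow>\<^sub>M PiM {..<n} (\<lambda>_. borel)"
    unfolding rot_def
  proof (rule measurable_PiM_single')
    fix i assume "i \<in> {..<n}"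
    then show "(\<lambda>x. (x(p := c * x p + s * x q, q := c * x q - s * x p)) i) \<in> borel_measurable (gauss n)"
      using assms by (cases "i = q"; cases "i = p") auto
  qed (use assms in \<open>auto simp: gauss_def space_PiM PiE_def extensional_def\<close>)
  then show ?thesis by (simp add: measurable_cong_sets[OF refl sets_gauss])
qed

lemma distr_gauss_rot:
  assumes pq: "p < n" "q < n" "p \<noteq> q" and cs: "c\<^sup>2 + s\<^sup>2 = 1"
  shows "distr (gauss n) (gauss n) (rot p q c s) = gauss n"
proof (rule measure_eqI)
  fix A assume "A \<in> sets (distr (gauss n) (gauss n) (rot p q c s))"
  then have A: "A \<in> sets (gauss n)" by simp
  let ?N = "\<lambda>_::nat. std_normal_distribution"
  let ?J = "{..<n} - {p, q}"
  have ins: "{..<n} = insert p (insert q ?J)" using pq by auto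
  have gauss: "(\<integral>\<^sup>+x. f x \<partial>gauss n) =
      (\<integral>\<^sup>+x. \<integral>\<^sup>+z. \<integral>\<^sup>+y. f (x(q := z, p := y)) \<partial>?N p \<partial>?N q \<partial>PiM ?J ?N)"
    if f: "f \<in> borel_measurable (gauss n)" for f
  proof -
    have [measurable]: "f \<in> borel_measurable (PiM (insert p (insert q ?J)) ?N)"
      using f ins by (simp add: gauss_def)
    have "(\<integral>\<^sup>+x. f x \<partial>gauss n) = (\<integral>\<^sup>+x. f x \<partial>PiM (insert p (insert q ?J)) ?N)"
      using ins by (simp add: gauss_def)
    also have "\<dots> = (\<integral>\<^sup>+x. \<integral>\<^sup>+y. f (x(p := y)) \<partial>?N p \<partial>PiM (insert q ?J) ?N)"
      using pq by (intro gauss.product_nn_integral_insert) auto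
    also have "\<dots> = (\<integral>\<^sup>+x. \<integral>\<^sup>+z. \<integral>\<^sup>+y. f (x(q := z, p := y)) \<partial>?N p \<partial>?N q \<partial>PiM ?J ?N)"
      by (rule gauss.product_nn_integral_insert) (auto, measurable)
    finally show ?thesis .
  qed
  have "emeasure (distr (gauss n) (gauss n) (rot p q c s)) A = (\<integral>\<^sup>+x. indicator A (rot p q c s x) \<partial>gauss n)"
    using A nn_integral_distr[OF measurable_rot[OF pq(1,2)], of "indicator A"]
    by (subst nn_integral_indicator[symmetric]) auto
  \<comment> \<open>Coordinate \<open>q\<close> is the outer variable here, so the plane rotation
    appears with its orientation reversed, hence with \<open>- s\<close>.\<close>
  also have "\<dots> = (\<integral>\<^sup>+x. \<integral>\<^sup>+z. \<integral>\<^sup>+y. indicator A (x(q := c * z + - s * y, p := c * y - - s * z)) \<partial>?N p \<partial>?N q \<partial>PiM ?J ?N)"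
    using pq by (subst gauss[OF measurable_compose[OF measurable_rot borel_measurable_indicator[OF A]]])
      (auto simp: rot_def fun_upd_twist intro!: nn_integral_cong)
  also have "\<dots> = (\<integral>\<^sup>+x. \<integral>\<^sup>+z. \<integral>\<^sup>+y. indicator A (x(q := z, p := y)) \<partial>?N p \<partial>?N q \<partial>PiM ?J ?N)"
  proof (rule nn_integral_cong)
    fix x assume x: "x \<in> space (PiM ?J ?N)"
    have "(\<lambda>v. x(q := fst v, p := snd v)) \<in> borel \<Otimes>\<^sub>M borel \<rightarrow>\<^sub>M PiM (insert p (insert q ?J)) ?N"
      using x by measurable
    moreover have "A \<in> sets (PiM (insert p (insert q ?J)) ?N)"
      using A ins by (simp add: gauss_def)
    ultimately have "(\<lambda>v. indicator A (x(q := fst v, p := snd v)) :: ennreal) \<in> borel_measurable borel"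
      by (auto simp: borel_prod)
    from nn_integral_rotation_std_normal[OF this, of c "- s"] cs
    show "(\<integral>\<^sup>+z. \<integral>\<^sup>+y. indicator A (x(q := c * z + - s * y, p := c * y - - s * z)) \<partial>?N p \<partial>?N q) =
        (\<integral>\<^sup>+z. \<integral>\<^sup>+y. indicator A (x(q := z, p := y)) \<partial>?N p \<partial>?N q)" by simp
  qed
  also have "\<dots> = emeasure (gauss n) A"
    using A by (subst gauss[symmetric]) auto
  finally show "emeasure (distr (gauss n) (gauss n) (rot p q c s)) A = emeasure (gauss n) A" .
qed simp

lemma ip_rot:
  assumes "p < n" "q < n" "p \<noteq> q" "c\<^sup>2 + s\<^sup>2 = 1"
  shows "ip n (rot p q c s x) (rot p q c s y) = ip n x y"
proof -
  have split: "ip n u v = u p * v p + u q * v q + (\<Sum>i\<in>{..<n}-{p, q}. u i * v i)" for u v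
    using assms(1-3) by (simp add: ip_def sum.remove[of "{..<n}" p] sum.remove[of "{..<n} - {p}" q]
        Diff_insert2[symmetric] insert_commute)
  have "(c * x p + s * x q) * (c * y p + s * y q) + (c * x q - s * x p) * (c * y q - s * y p) =
      (c\<^sup>2 + s\<^sup>2) * (x p * y p + x q * y q)"
    by (simp add: power2_eq_square algebra_simps)
  then show ?thesis
    using assms(3,4) by (simp add: split rot_def)
qed

section \<open>Equivariance and measurability of Gram--Schmidt\<close>

lemma gs_cong:
  assumes "\<And>l. l \<le> j \<Longrightarrow> g l = g' l"
  shows "gs n g j = gs n g' j" "gres n g j = gres n g' j"
proof -
  have *: "gs n g j = gs n g' j \<and> gres n g j = gres n g' j" if "\<And>l. l \<le> j \<Longrightarrow> g l = g' l" for j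
    using that
  proof (induction j rule: less_induct)
    case (less j)
    then have "gs n g l = gs n g' l" if "l < j" for l using that by auto
    then have "gres n g j = gres n g' j"
      using less.prems by (auto simp: gres_def[abs_def])
    then show ?case by (simp add: gs_eq)
  qed
  then show "gs n g j = gs n g' j" "gres n g j = gres n g' j" using assms by blast+
qed

text \<open>Gram--Schmidt is built from inner products and linear combinations, and a rotation
  respects both.\<close>

lemma gs_rot:
  assumes "p < n" "q < n" "p \<noteq> q" "c\<^sup>2 + s\<^sup>2 = 1"
  shows "gs n (\<lambda>l. rot p q c s (g l)) j = rot p q c s (gs n g j)"
proof (induction j rule: less_induct)
  case (less j)
  have "gres n (\<lambda>l. rot p q c s (g l)) j = rot p q c s (gres n g j)"
  proof
    fix i
    have IH: "(\<Sum>l<j. ip n (rot p q c s (g j)) (gs n (\<lambda>l. rot p q c s (g l)) l) * gs n (\<lambda>l. rot p q c s (g l)) l i) =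
        (\<Sum>l<j. ip n (g j) (gs n g l) * rot p q c s (gs n g l) i)"
      by (intro sum.cong) (simp_all add: less ip_rot[OF assms])
    show "gres n (\<lambda>l. rot p q c s (g l)) j i = rot p q c s (gres n g j) i"
      unfolding gres_def IH by (simp add: rot_def gres_def algebra_simps sum_distrib_left sum.distrib sum_subtractf)
  qed
  moreover have "vnorm n (rot p q c s x) = vnorm n x" for x
    by (simp add: vnorm_def ip_rot[OF assms])
  ultimately show ?case
    by (simp add: gs_eq) (simp add: rot_def fun_eq_iff add_divide_distrib diff_divide_distrib)
qed

text \<open>\<open>compose\<close> keeps the rotated family in the extensional space of
  \<open>gauss_tuple\<close>; by \<open>gs_cong\<close> the first \<open>k\<close> Gram--Schmidt
  vectors do not see what happens from \<open>k\<close> on.\<close>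

lemma proj_ip_gs_rot:
  assumes "p < n" "q < n" "p \<noteq> q" "c\<^sup>2 + s\<^sup>2 = 1"
  shows "proj_ip n k (gs n (compose {..<k} (rot p q c s) g)) (rot p q c s x) (rot p q c s y) =
    proj_ip n k (gs n g) x y"
proof -
  have "gs n (compose {..<k} (rot p q c s) g) l = rot p q c s (gs n g l)" if "l < k" for l
    using that unfolding gs_rot[OF assms, symmetric] by (intro gs_cong) (auto simp: compose_def)
  then show ?thesis by (simp add: proj_ip_def ip_rot[OF assms])
qed

abbreviation gauss_tuple :: "nat \<Rightarrow> nat \<Rightarrow> (nat \<Rightarrow> nat \<Rightarrow> real) measure" where
  "gauss_tuple n k \<equiv> PiM {..<k} (\<lambda>_. gauss n)"

lemma prob_space_gauss_tuple: "prob_space (gauss_tuple n k)"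
  by (intro prob_space_PiM prob_space_gauss)

lemma distr_gauss_tuple_rot:
  assumes "p < n" "q < n" "p \<noteq> q" "c\<^sup>2 + s\<^sup>2 = 1"
  shows "distr (gauss_tuple n k) (gauss_tuple n k) (compose {..<k} (rot p q c s)) = gauss_tuple n k"
  using assms by (subst distr_PiM_finite_prob_space')
    (auto simp: prob_space_gauss distr_gauss_rot)

lemma measurable_gs:
  assumes "\<And>l i. l \<le> j \<Longrightarrow> i < n \<Longrightarrow> (\<lambda>w. G w l i) \<in> borel_measurable M" "i < n"
  shows "(\<lambda>w. gs n (G w) j i) \<in> borel_measurable M" "(\<lambda>w. gres n (G w) j i) \<in> borel_measurable M"
proof -
  have *: "(\<lambda>w. gs n (G w) j i) \<in> borel_measurable M \<and> (\<lambda>w. gres n (G w) j i) \<in> borel_measurable M" 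
    if "\<And>l i. l \<le> j \<Longrightarrow> i < n \<Longrightarrow> (\<lambda>w. G w l i) \<in> borel_measurable M" "i < n" for j i
    using that
  proof (induction j arbitrary: i rule: less_induct)
    case (less j)
    have 1: "(\<lambda>w. gres n (G w) j i) \<in> borel_measurable M" if "i < n" for i
      unfolding gres_def using less that
      by (intro borel_measurable_diff borel_measurable_sum borel_measurable_times measurable_ip) auto
    have "(\<lambda>w. vnorm n (gres n (G w) j)) \<in> borel_measurable M"
      unfolding vnorm_def by (intro measurable_compose[OF _ borel_measurable_sqrt] measurable_ip 1)
    then show ?case using 1 less.prems unfolding gs_eq by (auto intro!: borel_measurable_divide)
  qed
  from *[OF assms] show "(\<lambda>w. gs n (G w) j i) \<in> borel_measurable M" "(\<lambda>w. gres n (G w) j i) \<in> borel_measurable M"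
    by auto
qed

lemma measurable_proj_ip_gs:
  assumes "\<And>l i. l < k \<Longrightarrow> i < n \<Longrightarrow> (\<lambda>w. G w l i) \<in> borel_measurable M"
    and "\<And>i. i < n \<Longrightarrow> (\<lambda>w. x w i) \<in> borel_measurable M"
    and "\<And>i. i < n \<Longrightarrow> (\<lambda>w. y w i) \<in> borel_measurable M"
  shows "(\<lambda>w. proj_ip n k (gs n (G w)) (x w) (y w)) \<in> borel_measurable M"
  unfolding proj_ip_def using assms
  by (intro borel_measurable_sum borel_measurable_times measurable_ip measurable_gs) auto

lemma measurable_gauss_tuple_component [measurable]:
  "l < k \<Longrightarrow> i < n \<Longrightarrow> (\<lambda>g. g l i) \<in> borel_measurable (gauss_tuple n k)"
  by (rule measurable_compose[OF measurable_component_singleton[of l "{..<k}" "\<lambda>_. gauss n"]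
        measurable_gauss_component[of i n]]) auto

text \<open>The failure event of the Johnson--Lindenstrauss estimate; \<open>n / k\<close> makes up
  for the average loss of squared length under projection. As the inequality is strict, a zero
  vector is never distorted.\<close>

definition distorted :: "nat \<Rightarrow> nat \<Rightarrow> real \<Rightarrow> (nat \<Rightarrow> nat \<Rightarrow> real) \<Rightarrow> (nat \<Rightarrow> real) \<Rightarrow> bool" where
  "distorted n k \<eta> g x \<longleftrightarrow> \<bar>real n / real k * proj_ip n k (gs n g) x x - ip n x x\<bar> > \<eta> * ip n x x"

lemma measurable_distorted_pair [measurable]:
  "Measurable.pred (gauss_tuple n k \<Otimes>\<^sub>M gauss n) (\<lambda>w. distorted n k \<eta> (fst w) (snd w))"
proof -
  have [measurable]: "(\<lambda>w. proj_ip n k (gs n (fst w)) (snd w) (snd w)) \<in> borel_measurable (gauss_tuple n k \<Otimes>\<^sub>M gauss n)"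
    by (intro measurable_proj_ip_gs) (auto intro!: measurable_compose[OF measurable_fst measurable_gauss_tuple_component] 
          measurable_compose[OF measurable_snd measurable_gauss_component])
  have [measurable]: "(\<lambda>w. ip n (snd w) (snd w)) \<in> borel_measurable (gauss_tuple n k \<Otimes>\<^sub>M gauss n)"
    by (intro measurable_ip) (auto intro!: measurable_compose[OF measurable_snd measurable_gauss_component])
  show ?thesis unfolding distorted_def by measurable
qed

lemma measurable_proj_ip_gs' [measurable]:
  "(\<lambda>g. proj_ip n k (gs n g) x y) \<in> borel_measurable (gauss_tuple n k)"
  by (intro measurable_proj_ip_gs) auto

lemma measurable_distorted [measurable]: "Measurable.pred (gauss_tuple n k) (\<lambda>g. distorted n k \<eta> g x)"
  unfolding distorted_def by measurable

lemma distorted_scale: "a \<noteq> 0 \<Longrightarrow> distorted n k \<eta> g (\<lambda>i. a * x i) \<longleftrightarrow> distorted n k \<eta> g x"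
proof -
  assume a: "a \<noteq> 0"
  have "proj_ip n k (gs n g) (\<lambda>i. a * x i) (\<lambda>i. a * x i) = a\<^sup>2 * proj_ip n k (gs n g) x x"
    by (simp add: proj_ip_def ip_right sum_distrib_left power2_eq_square mult_ac)
  moreover have "ip n (\<lambda>i. a * x i) (\<lambda>i. a * x i) = a\<^sup>2 * ip n x x"
    by (simp add: ip_right ip_left power2_eq_square)
  ultimately have "distorted n k \<eta> g (\<lambda>i. a * x i) \<longleftrightarrow>
      a\<^sup>2 * (\<eta> * ip n x x) < \<bar>a\<^sup>2 * (real n / real k * proj_ip n k (gs n g) x x - ip n x x)\<bar>"
    by (simp add: distorted_def algebra_simps)
  then show ?thesis using a by (simp add: abs_mult distorted_def)
qed

lemma distorted_cong: "(\<And>i. i < n \<Longrightarrow> x i = y i) \<Longrightarrow> distorted n k \<eta> g x \<longleftrightarrow> distorted n k \<eta> g y"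
  using ip_cong[of n x y x y] ip_cong[of n "gs n g _" "gs n g _" x y] by (simp add: distorted_def proj_ip_def)

text \<open>Rotating the vector and the family together does not change the event, and rotating the
  family alone does not change its law.\<close>

lemma emeasure_distorted_rot:
  assumes "p < n" "q < n" "p \<noteq> q" "c\<^sup>2 + s\<^sup>2 = 1"
  shows "emeasure (gauss_tuple n k) {g \<in> space (gauss_tuple n k). distorted n k \<eta> g (rot p q c s x)} =
    emeasure (gauss_tuple n k) {g \<in> space (gauss_tuple n k). distorted n k \<eta> g x}"
proof -
  let ?M = "gauss_tuple n k" and ?T = "compose {..<k} (rot p q c s)"
  have T: "?T \<in> ?M \<rightarrow>\<^sub>M ?M"
    unfolding compose_def using assms by measurable
  have "emeasure ?M {g \<in> space ?M. distorted n k \<eta> g (rot p q c s x)} =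
      emeasure (distr ?M ?M ?T) {g \<in> space ?M. distorted n k \<eta> g (rot p q c s x)}"
    by (simp add: distr_gauss_tuple_rot[OF assms])
  also have "\<dots> = emeasure ?M (?T -` {g \<in> space ?M. distorted n k \<eta> g (rot p q c s x)} \<inter> space ?M)"
    by (rule emeasure_distr[OF T]) measurable
  also have "?T -` {g \<in> space ?M. distorted n k \<eta> g (rot p q c s x)} \<inter> space ?M = {g \<in> space ?M. distorted n k \<eta> g x}"
    using measurable_space[OF T] by (auto simp: distorted_def proj_ip_gs_rot[OF assms] ip_rot[OF assms])
  finally show ?thesis .
qed

text \<open>The coordinates are rotated into coordinate 0 one after the other, until a multiple of
  the first unit vector is left; the event ignores scale. Thus all nonzero vectors share one failure
  probability.\<close>

lemma emeasure_distorted_const: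
  assumes "i < n" "x i \<noteq> 0"
  shows "emeasure (gauss_tuple n k) {g \<in> space (gauss_tuple n k). distorted n k \<eta> g x} =
    emeasure (gauss_tuple n k) {g \<in> space (gauss_tuple n k). distorted n k \<eta> g (\<lambda>i. if i = 0 then 1 else 0)}"
proof -
  let ?\<Phi> = "\<lambda>x. emeasure (gauss_tuple n k) {g \<in> space (gauss_tuple n k). distorted n k \<eta> g x}"
  let ?e = "\<lambda>i. if i = 0 then 1 else 0 :: real"
  have "?\<Phi> x = ?\<Phi> ?e" if "\<forall>i. q < i \<and> i < n \<longrightarrow> x i = 0" "ip n x x \<noteq> 0" "q < n" for q x
    using that
  proof (induction q arbitrary: x)
    case 0
    then have eq: "x i = x 0 * ?e i" if "i < n" for i using that by (cases i) auto
    have "x 0 \<noteq> 0"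
    proof
      assume "x 0 = 0"
      then have "ip n x x = 0" using eq by (simp add: ip_self_eq_0_iff)
      then show False using 0 by simp
    qed
    then show ?case
      using distorted_cong[of n x "\<lambda>i. x 0 * ?e i", OF eq] distorted_scale[of "x 0" n k \<eta> _ ?e] by simp
  next
    case (Suc q)
    define r where "r = sqrt ((x 0)\<^sup>2 + (x (Suc q))\<^sup>2)"
    show ?case
    proof (cases "x (Suc q) = 0")
      case True
      then have "x i = 0" if "q < i \<and> i < n" for i
        using Suc.prems(1) that by (cases "i = Suc q") auto
      then show ?thesis using Suc by auto
    next
      case False
      then have r: "r > 0" "r\<^sup>2 = (x 0)\<^sup>2 + (x (Suc q))\<^sup>2"
        by (auto simp: r_def add_nonneg_pos)
      \<comment> \<open>This angle makes coordinate \<open>Suc q\<close> of the rotated vector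
        vanish and gives coordinate 0 the value \<open>r\<close>.\<close>
      let ?c = "x 0 / r" and ?s = "x (Suc q) / r"
      have cs: "?c\<^sup>2 + ?s\<^sup>2 = 1"
        using r(1) by (simp add: power_divide add_divide_distrib[symmetric] r(2)[symmetric])
      let ?y = "rot 0 (Suc q) ?c ?s x"
      have "?\<Phi> x = ?\<Phi> ?y"
        using Suc.prems cs by (intro emeasure_distorted_rot[symmetric]) auto
      also have "\<dots> = ?\<Phi> ?e"
      proof (rule Suc.IH)
        show "\<forall>i. q < i \<and> i < n \<longrightarrow> ?y i = 0"
          using Suc.prems(1) by (auto simp: rot_def)
        show "ip n ?y ?y \<noteq> 0" using Suc.prems cs by (subst ip_rot) auto
      qed (use Suc.prems in auto)
      finally show ?thesis .
    qed
  qed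
  from this[of "n - 1" x] show ?thesis using assms by (force simp: ip_self_eq_0_iff)
qed

text \<open>With the other coordinates frozen, only one value of \<open>x l\<close> makes the inner
  product vanish.\<close>

lemma AE_gauss_ip_neq_0:
  assumes "l < n" "a l \<noteq> 0"
  shows "AE x in gauss n. ip n a x \<noteq> 0"
proof -
  let ?N = "\<lambda>_::nat. std_normal_distribution"
  let ?J = "{..<n} - {l}"
  let ?A = "{x \<in> space (gauss n). ip n a x = 0}"
  have ins: "{..<n} = insert l ?J" using assms by auto
  have A: "?A \<in> sets (gauss n)" by measurable
  then have "indicator ?A \<in> borel_measurable (PiM (insert l ?J) ?N)"
    using ins by (simp add: gauss_def)
  then have "emeasure (gauss n) ?A = (\<integral>\<^sup>+x. \<integral>\<^sup>+t. indicator ?A (x(l := t)) \<partial>?N l \<partial>PiM ?J ?N)"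
    using A gauss.product_nn_integral_insert[of ?J l "indicator ?A"] ins
    by (simp add: gauss_def)
  also have "\<dots> = (\<integral>\<^sup>+x. 0 \<partial>PiM ?J ?N)"
  proof (rule nn_integral_cong)
    fix x
    let ?b = "\<Sum>i\<in>?J. a i * x i"
    have eq: "ip n a (x(l := t)) = ?b + a l * t" for t
      unfolding ip_def by (subst ins, subst sum.insert) auto
    have "AE t in lborel. t \<noteq> - ?b / a l" by (rule AE_lborel_singleton)
    then have "AE t in ?N l. indicator ?A (x(l := t)) = (0 :: ennreal)"
      using assms(2) by (subst AE_density) (auto simp: eq field_simps indicator_def elim!: eventually_mono)
    then have "(\<integral>\<^sup>+t. indicator ?A (x(l := t)) \<partial>?N l) = (\<integral>\<^sup>+t. 0 \<partial>?N l)"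
      by (rule nn_integral_cong_AE)
    then show "(\<integral>\<^sup>+t. indicator ?A (x(l := t)) \<partial>?N l) = 0" by simp
  qed
  finally have "emeasure (gauss n) ?A = 0" by simp
  then show ?thesis using A by (intro AE_I[where N = ?A]) auto
qed

lemma AE_indep:
  assumes "k \<le> n"
  shows "AE g in gauss_tuple n k. indep n k g"
proof -
  interpret G: product_sigma_finite "\<lambda>_::nat. gauss n"
    by (intro product_sigma_finite.intro prob_space_imp_sigma_finite prob_space_gauss)
  let ?M = "gauss_tuple n k"
  have "AE g in ?M. vnorm n (gres n g j) \<noteq> 0" if j: "j < k" for j
  proof -
    let ?A = "{g \<in> space ?M. vnorm n (gres n g j) = 0}"
    let ?J = "{..<k} - {j}"
    have ins: "{..<k} = insert j ?J" using j by auto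
    have "(\<lambda>g. vnorm n (gres n g j)) \<in> borel_measurable ?M"
      unfolding vnorm_def using j
      by (intro measurable_compose[OF _ borel_measurable_sqrt] measurable_ip measurable_gs) auto
    then have A: "?A \<in> sets ?M" by measurable
    then have "indicator ?A \<in> borel_measurable (PiM (insert j ?J) (\<lambda>_. gauss n))"
      using ins by simp
    then have "emeasure ?M ?A = (\<integral>\<^sup>+g. \<integral>\<^sup>+h. indicator ?A (g(j := h)) \<partial>gauss n \<partial>PiM ?J (\<lambda>_. gauss n))"
      using A G.product_nn_integral_insert[of ?J j "indicator ?A"] ins by simp
    also have "\<dots> = (\<integral>\<^sup>+g. 0 \<partial>PiM ?J (\<lambda>_. gauss n))"
    proof (rule nn_integral_cong)
      fix g
      \<comment> \<open>The projections of the \<open>n\<close> unit vectors onto the span of the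
        earlier vectors have squared lengths of total at most \<open>j < n\<close>, so some unit
        vector lies outside that span.\<close>
      have "(\<Sum>i<n. \<Sum>l<j. (gs n g l i)\<^sup>2) = (\<Sum>l<j. ip n (gs n g l) (gs n g l))"
        by (subst sum.swap) (simp add: ip_def power2_eq_square)
      also have "\<dots> \<le> (\<Sum>l<j. 1)" by (intro sum_mono) (simp add: gs_self)
      also have "\<dots> < (\<Sum>i<n. 1)" using j assms by simp
      finally obtain i0 where i0: "i0 < n" "(\<Sum>l<j. (gs n g l i0)\<^sup>2) < 1"
        by (meson lessThan_iff linorder_not_less sum_mono)
      \<comment> \<open>The residual of the unit vector at \<open>i0\<close>. As a projection is
        symmetric, coordinate \<open>i0\<close> of the residual of \<open>h\<close> is the inner
        product of \<open>?a\<close> with \<open>h\<close>.\<close>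
      let ?a = "\<lambda>i. (if i = i0 then 1 else 0) - (\<Sum>l<j. gs n g l i0 * gs n g l i)"
      have gs: "gs n (g(j := h)) l = gs n g l" if "l < j" for h l
        using that by (intro gs_cong) auto
      have "gres n (g(j := h)) j i0 = h i0 - (\<Sum>l<j. gs n g l i0 * ip n (gs n g l) h)" for h
        by (auto simp: gres_def gs ip_commute[of n h] mult.commute intro!: sum.cong)
      then have "ip n ?a h = gres n (g(j := h)) j i0" for h
        using i0 by (simp add: ip_diff_left ip_sum_left ip_scale_left)
          (simp add: ip_def if_distrib[of "\<lambda>a. a * _"] cong: if_cong)
      moreover have "AE h in gauss n. ip n ?a h \<noteq> 0"
        using i0 by (intro AE_gauss_ip_neq_0[of i0]) (auto simp: power2_eq_square)
      ultimately have "AE h in gauss n. indicator ?A (g(j := h)) = (0 :: ennreal)"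
        using i0 by (auto simp: vnorm_eq_0_iff indicator_def elim!: eventually_mono)
      then have "(\<integral>\<^sup>+h. indicator ?A (g(j := h)) \<partial>gauss n) = (\<integral>\<^sup>+h. 0 \<partial>gauss n)"
        by (rule nn_integral_cong_AE)
      then show "(\<integral>\<^sup>+h. indicator ?A (g(j := h)) \<partial>gauss n) = 0" by simp
    qed
    finally have "emeasure ?M ?A = 0" by simp
    then show ?thesis using A by (intro AE_I[where N = ?A]) auto
  qed
  then have "AE g in ?M. \<forall>j\<in>{..<k}. vnorm n (gres n g j) \<noteq> 0"
    by (intro AE_finite_allI) auto
  then show ?thesis by (simp add: indep_def Ball_def)
qed

text \<open>By rotation invariance the fixed vector may be replaced by a Gaussian one, independent of
  the subspace; conditioning on the subspace then leaves a statement about a fixed subspace.\<close>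

lemma emeasure_distorted_le:
  assumes "k \<le> n" "\<And>g. indep n k g \<Longrightarrow> emeasure (gauss n) {h \<in> space (gauss n). distorted n k \<eta> g h} \<le> B"
  shows "emeasure (gauss_tuple n k) {g \<in> space (gauss_tuple n k). distorted n k \<eta> g x} \<le> B"
proof (cases "\<exists>i<n. x i \<noteq> 0")
  case False
  then have "ip n x x = 0" "ip n y x = 0" for y by (simp_all add: ip_def)
  then show ?thesis by (simp add: distorted_def proj_ip_def)
next
  case True
  then obtain i where i: "i < n" "x i \<noteq> 0" by auto
  let ?M = "gauss_tuple n k"
  interpret M: prob_space ?M by (rule prob_space_gauss_tuple)
  interpret G: prob_space "gauss n" by (rule prob_space_gauss)
  interpret pair_sigma_finite ?M "gauss n" ..
  let ?\<Phi> = "\<lambda>x. emeasure ?M {g \<in> space ?M. distorted n k \<eta> g x}"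
  let ?I = "\<lambda>g h. indicator {w. distorted n k \<eta> (fst w) (snd w)} (g, h) :: ennreal"
  have ind: "(\<integral>\<^sup>+g. ?I g h \<partial>?M) = ?\<Phi> h" for h
  proof -
    have "(\<integral>\<^sup>+g. ?I g h \<partial>?M) = (\<integral>\<^sup>+g. indicator {g \<in> space ?M. distorted n k \<eta> g h} g \<partial>?M)"
      by (intro nn_integral_cong) (simp add: indicator_def)
    then show ?thesis by simp
  qed
  have ind': "(\<integral>\<^sup>+h. ?I g h \<partial>gauss n) = emeasure (gauss n) {h \<in> space (gauss n). distorted n k \<eta> g h}"
    if "g \<in> space ?M" for g
  proof -
    have "(\<integral>\<^sup>+h. ?I g h \<partial>gauss n) = (\<integral>\<^sup>+h. indicator {h \<in> space (gauss n). distorted n k \<eta> g h} h \<partial>gauss n)"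
      by (intro nn_integral_cong) (simp add: indicator_def)
    then show ?thesis
      using measurable_compose[OF measurable_Pair1'[OF that] measurable_distorted_pair] by simp
  qed
  \<comment> \<open>This inner product is \<open>h i\<close>; so a Gaussian \<open>h\<close> is
    almost surely nonzero and shares the failure probability of \<open>x\<close>.\<close>
  have "AE h in gauss n. ip n (\<lambda>j. if j = i then 1 else 0) h \<noteq> 0"
    using i by (intro AE_gauss_ip_neq_0[of i]) auto
  then have "AE h in gauss n. ?\<Phi> h = ?\<Phi> x"
  proof (rule eventually_mono)
    fix h assume "ip n (\<lambda>j. if j = i then 1 else 0) h \<noteq> 0"
    then have "h i \<noteq> 0" using i by (simp add: ip_def if_distrib[of "\<lambda>a. a * _"] cong: if_cong)
    then show "?\<Phi> h = ?\<Phi> x" using emeasure_distorted_const[of i n h k \<eta>] emeasure_distorted_const[of i n x k \<eta>] i by simp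
  qed
  then have "(\<integral>\<^sup>+h. ?\<Phi> h \<partial>gauss n) = (\<integral>\<^sup>+h. ?\<Phi> x \<partial>gauss n)" by (rule nn_integral_cong_AE)
  then have "?\<Phi> x = (\<integral>\<^sup>+h. \<integral>\<^sup>+g. ?I g h \<partial>?M \<partial>gauss n)"
    by (simp add: ind G.emeasure_space_1)
  also have "\<dots> = (\<integral>\<^sup>+g. \<integral>\<^sup>+h. ?I g h \<partial>gauss n \<partial>?M)"
    by (rule Fubini') (simp add: case_prod_unfold)
  also have "\<dots> \<le> (\<integral>\<^sup>+g. B \<partial>?M)"
  proof (rule nn_integral_mono_AE)
    show "AE g in ?M. (\<integral>\<^sup>+h. ?I g h \<partial>gauss n) \<le> B"
      using AE_indep[OF assms(1)] AE_space by eventually_elim (simp add: ind' assms(2))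
  qed
  finally show ?thesis by (simp add: M.emeasure_space_1)
qed

section \<open>Concentration of projected lengths\<close>

lemma std_normal_mgf: "(\<integral>\<^sup>+x. ennreal (exp (a * x)) \<partial>std_normal_distribution) = ennreal (exp (a\<^sup>2 / 2))"
proof -
  have eq: "std_normal_density x * exp (a * x) = exp (a\<^sup>2 / 2) * normal_density a 1 x" for x
  proof -
    have "- x\<^sup>2 / 2 + a * x = a\<^sup>2 / 2 + - (x - a)\<^sup>2 / 2"
      by (simp add: power2_eq_square field_simps)
    then have "exp (- x\<^sup>2 / 2) * exp (a * x) = exp (a\<^sup>2 / 2) * exp (- (x - a)\<^sup>2 / 2)"
      by (simp only: exp_add[symmetric])
    then show ?thesis by (simp add: normal_density_def)
  qed
  have "(\<integral>\<^sup>+x. ennreal (exp (a * x)) \<partial>std_normal_distribution) =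
      (\<integral>\<^sup>+x. ennreal (exp (a\<^sup>2 / 2)) * ennreal (normal_density a 1 x) \<partial>lborel)"
    by (simp add: nn_integral_density eq ennreal_mult[symmetric])
  also have "\<dots> = ennreal (exp (a\<^sup>2 / 2))"
    using prob_space.emeasure_space_1[OF prob_space_normal_density[of 1 a]]
    by (simp add: nn_integral_cmult emeasure_density)
  finally show ?thesis .
qed

text \<open>Multiplying the standard normal density by \<open>exp (t * x\<^sup>2)\<close> gives
  \<open>\<sigma>\<close> times the centred normal density of variance
  \<open>1 / (1 - 2 * t)\<close>.\<close>

lemma std_normal_exp_square:
  assumes "t < 1/2"
  shows "(\<integral>\<^sup>+x. ennreal (exp (t * x\<^sup>2)) \<partial>std_normal_distribution) = ennreal (1 / sqrt (1 - 2 * t))"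
proof -
  define \<sigma> where "\<sigma> = 1 / sqrt (1 - 2 * t)"
  have \<sigma>: "\<sigma> > 0" "\<sigma>\<^sup>2 = 1 / (1 - 2 * t)" using assms by (auto simp: \<sigma>_def power_divide)
  have eq: "std_normal_density x * exp (t * x\<^sup>2) = \<sigma> * normal_density 0 \<sigma> x" for x
  proof -
    have "- x\<^sup>2 / 2 + t * x\<^sup>2 = - x\<^sup>2 / (2 * \<sigma>\<^sup>2)"
      using assms by (simp add: \<sigma>(2) field_simps)
    then have "exp (- x\<^sup>2 / 2) * exp (t * x\<^sup>2) = exp (- x\<^sup>2 / (2 * \<sigma>\<^sup>2))"
      by (simp only: exp_add[symmetric])
    then show ?thesis using \<sigma>(1) by (simp add: normal_density_def real_sqrt_mult)
  qed
  have "(\<integral>\<^sup>+x. ennreal (exp (t * x\<^sup>2)) \<partial>std_normal_distribution) =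
      (\<integral>\<^sup>+x. ennreal \<sigma> * ennreal (normal_density 0 \<sigma> x) \<partial>lborel)"
    using \<sigma>(1) by (simp add: nn_integral_density eq ennreal_mult[symmetric])
  also have "\<dots> = ennreal \<sigma>"
    using prob_space.emeasure_space_1[OF prob_space_normal_density[of \<sigma> 0]] \<sigma>(1)
    by (simp add: nn_integral_cmult emeasure_density)
  finally show ?thesis by (simp add: \<sigma>_def)
qed

lemma std_normal_exp_square_le:
  assumes "\<bar>t\<bar> \<le> 1/4"
  shows "(\<integral>\<^sup>+x. ennreal (exp (t * x\<^sup>2)) \<partial>std_normal_distribution) \<le> ennreal (exp (t + 4 * t\<^sup>2))"
proof -
  \<comment> \<open>The second-order bound for the logarithm needs \<open>2 * t \<le> 1 / 2\<close>,
    whence the range of \<open>t\<close>. Halving it gives the exponent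
    \<open>t + 4 * t\<^sup>2\<close>.\<close>
  have "- (2 * t) - 2 * (2 * t)\<^sup>2 \<le> ln (1 - 2 * t)"
    using ln_one_minus_pos_lower_bound[of "2 * t"] ln_one_plus_pos_lower_bound[of "- 2 * t"] assms
    by (cases "t \<ge> 0") (auto intro: order_trans[of _ "- (2 * t) - 4 * t\<^sup>2"])
  then have "exp (- (2 * t) - 2 * (2 * t)\<^sup>2) \<le> 1 - 2 * t"
    using assms by (subst (asm) exp_le_cancel_iff[symmetric]) (simp del: exp_le_cancel_iff)
  moreover have "- (2 * t) - 2 * (2 * t)\<^sup>2 = 2 * (- t - 4 * t\<^sup>2)"
    by (simp add: power_mult_distrib)
  ultimately have "(exp (- t - 4 * t\<^sup>2))\<^sup>2 \<le> 1 - 2 * t"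
    by (simp only: exp_double)
  then have "exp (- t - 4 * t\<^sup>2) \<le> sqrt (1 - 2 * t)"
    by (rule real_le_rsqrt)
  then have "1 / sqrt (1 - 2 * t) \<le> 1 / exp (- t - 4 * t\<^sup>2)"
    using assms by (intro divide_left_mono mult_pos_pos) auto
  also have "\<dots> = exp (t + 4 * t\<^sup>2)"
    by (simp add: exp_minus[symmetric] divide_inverse)
  finally have "1 / sqrt (1 - 2 * t) \<le> exp (t + 4 * t\<^sup>2)" .
  then show ?thesis using assms by (subst std_normal_exp_square) (auto intro: ennreal_leI)
qed

section \<open>Exponential moments of Gaussian vectors\<close>

lemma nn_integral_gauss_prod:
  assumes "\<And>i. i < n \<Longrightarrow> f i \<in> borel_measurable borel"
  shows "(\<integral>\<^sup>+x. (\<Prod>i<n. f i (x i)) \<partial>gauss n) = (\<Prod>i<n. \<integral>\<^sup>+t. f i t \<partial>std_normal_distribution)"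
  unfolding gauss_def using assms by (intro gauss.product_nn_integral_prod) auto

lemma gauss_mgf: "(\<integral>\<^sup>+x. ennreal (exp (ip n a x)) \<partial>gauss n) = ennreal (exp (ip n a a / 2))"
proof -
  have "(\<integral>\<^sup>+x. ennreal (exp (ip n a x)) \<partial>gauss n) = (\<integral>\<^sup>+x. (\<Prod>i<n. ennreal (exp (a i * x i))) \<partial>gauss n)"
    by (simp add: ip_def exp_sum prod_ennreal)
  also have "\<dots> = (\<Prod>i<n. ennreal (exp ((a i)\<^sup>2 / 2)))"
    by (subst nn_integral_gauss_prod) (auto simp: std_normal_mgf)
  also have "\<dots> = ennreal (exp (ip n a a / 2))"
    by (simp add: ip_def exp_sum[symmetric] prod_ennreal sum_divide_distrib power2_eq_square)
  finally show ?thesis .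
qed

lemma gauss_char: "(LINT x|gauss n. iexp (ip n a x)) = complex_of_real (exp (- ip n a a / 2))"
proof -
  have int: "integrable std_normal_distribution (\<lambda>t. iexp (b * t))" for b
    by (rule std_normal.integrable_const_bound[where B = 1]) auto
  have "(LINT x|gauss n. iexp (ip n a x)) = (LINT x|gauss n. (\<Prod>i<n. iexp (a i * x i)))"
    by (simp add: ip_def exp_sum[symmetric] sum_distrib_left)
  also have "\<dots> = (\<Prod>i<n. LINT t|std_normal_distribution. iexp (a i * t))"
    unfolding gauss_def by (rule gauss.product_integral_prod) (simp, rule int)
  also have "\<dots> = (\<Prod>i<n. complex_of_real (exp (- (a i)\<^sup>2 / 2)))"
    using char_std_normal_distribution by (simp add: char_def fun_eq_iff)
  also have "\<dots> = complex_of_real (exp (- ip n a a / 2))"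
    by (simp add: ip_def exp_sum[symmetric] sum_divide_distrib sum_negf power2_eq_square flip: of_real_prod)
  finally show ?thesis .
qed

lemma gauss_cos: "(LINT x|gauss n. cos (ip n a x)) = exp (- ip n a a / 2)"
proof -
  interpret prob_space "gauss n" by (rule prob_space_gauss)
  have "integrable (gauss n) (\<lambda>x. iexp (ip n a x))"
    by (rule integrable_const_bound[where B = 1]) auto
  from integral_Re[OF this] show ?thesis by (simp add: gauss_char Re_exp)
qed

definition orthonormal :: "nat \<Rightarrow> nat \<Rightarrow> (nat \<Rightarrow> nat \<Rightarrow> real) \<Rightarrow> bool" where
  "orthonormal n k u \<longleftrightarrow> (\<forall>j<k. \<forall>l<k. ip n (u j) (u l) = (if j = l then 1 else 0))"

lemma orthonormal_ip_comb:
  assumes "orthonormal n k u"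
  shows "ip n (\<lambda>i. \<Sum>l<k. a l * u l i) (\<lambda>i. \<Sum>l<k. a l * u l i) = ip k a a"
proof -
  have "(\<Sum>l<k. a l * (\<Sum>j<k. a j * ip n (u l) (u j))) = (\<Sum>l<k. a l * a l)"
  proof (intro sum.cong refl)
    fix l assume "l \<in> {..<k}"
    then have "(\<Sum>j<k. a j * ip n (u l) (u j)) = (\<Sum>j<k. if j = l then a l else 0)"
      using assms by (intro sum.cong) (auto simp: orthonormal_def)
    then show "a l * (\<Sum>j<k. a j * ip n (u l) (u j)) = a l * a l"
      using \<open>l \<in> {..<k}\<close> by simp
  qed
  then show ?thesis by (simp add: ip_left ip_right) (simp add: ip_def)
qed

lemma nn_integral_gauss_exp_square:
  "(\<integral>\<^sup>+z. ennreal (exp (t * ip k z z)) \<partial>gauss k) =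
    (\<integral>\<^sup>+x. ennreal (exp (t * x\<^sup>2)) \<partial>std_normal_distribution) ^ k"
proof -
  have "(\<integral>\<^sup>+z. ennreal (exp (t * ip k z z)) \<partial>gauss k) = (\<integral>\<^sup>+z. (\<Prod>i<k. ennreal (exp (t * (z i)\<^sup>2))) \<partial>gauss k)"
    by (simp add: ip_def sum_distrib_left exp_sum prod_ennreal power2_eq_square)
  then show ?thesis
    by (subst (asm) nn_integral_gauss_prod) auto
qed

text \<open>Gaussian linearisation: \<open>exp (t y\<^sup>2)\<close> is the average of \<open>exp (sqrt (2 t) y z)\<close> over a standard
  normal \<open>z\<close>. After exchanging the integrals, orthonormality decouples the coordinates.\<close>

lemma mgf_orthonormal_pos:
  assumes u: "orthonormal n k u" and "t \<ge> 0"
  shows "(\<integral>\<^sup>+h. ennreal (exp (t * proj_ip n k u h h)) \<partial>gauss n) =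
    (\<integral>\<^sup>+z. ennreal (exp (t * ip k z z)) \<partial>gauss k)"
proof -
  interpret G: prob_space "gauss n" by (rule prob_space_gauss)
  interpret K: prob_space "gauss k" by (rule prob_space_gauss)
  interpret pair_sigma_finite "gauss k" "gauss n" ..
  let ?s = "sqrt (2 * t)"
  let ?v = "\<lambda>z i. ?s * (\<Sum>l<k. z l * u l i)"
  let ?w = "\<lambda>h l. ?s * ip n (u l) h"
  \<comment> \<open>One bilinear form in \<open>z\<close> and \<open>h\<close>, read as linear in
    \<open>h\<close> on the left and in \<open>z\<close> on the right, so that the Gaussian integral
    can be taken over either.\<close>
  have swap: "ip n (?v z) h = ip k (?w h) z" for z h
    by (simp add: ip_left) (simp add: ip_def[of k] sum_distrib_left mult_ac)
  have v: "ip n (?v z) (?v z) / 2 = t * ip k z z" for z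
    using assms(2) by (simp only: ip_scale_left ip_scale_right orthonormal_ip_comb[OF u]) simp
  have w: "ip k (?w h) (?w h) / 2 = t * proj_ip n k u h h" for h
    using assms(2) by (simp add: ip_scale_left ip_scale_right) (simp add: ip_def[of k] proj_ip_def)
  have [measurable]: "(\<lambda>p. ip n (?v (fst p)) (snd p)) \<in> borel_measurable (gauss k \<Otimes>\<^sub>M gauss n)"
    by (intro measurable_ip borel_measurable_times borel_measurable_sum borel_measurable_const
        measurable_compose[OF measurable_fst measurable_gauss_component]
        measurable_compose[OF measurable_snd measurable_gauss_component]) auto
  have "(\<integral>\<^sup>+h. ennreal (exp (t * proj_ip n k u h h)) \<partial>gauss n) =
      (\<integral>\<^sup>+h. \<integral>\<^sup>+z. ennreal (exp (ip n (?v z) h)) \<partial>gauss k \<partial>gauss n)"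
    by (simp only: swap gauss_mgf w)
  also have "\<dots> = (\<integral>\<^sup>+z. \<integral>\<^sup>+h. ennreal (exp (ip n (?v z) h)) \<partial>gauss n \<partial>gauss k)"
    by (rule Fubini') (simp add: case_prod_unfold)
  also have "\<dots> = (\<integral>\<^sup>+z. ennreal (exp (t * ip k z z)) \<partial>gauss k)"
    by (simp only: gauss_mgf v)
  finally show ?thesis .
qed

text \<open>For a negative coefficient the linearisation uses the characteristic function instead.\<close>

lemma mgf_orthonormal_neg:
  assumes u: "orthonormal n k u" and "t \<ge> 0"
  shows "(\<integral>\<^sup>+h. ennreal (exp (- t * proj_ip n k u h h)) \<partial>gauss n) =
    (\<integral>\<^sup>+z. ennreal (exp (- t * ip k z z)) \<partial>gauss k)"
proof -
  interpret G: prob_space "gauss n" by (rule prob_space_gauss)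
  interpret K: prob_space "gauss k" by (rule prob_space_gauss)
  interpret pair_prob_space "gauss k" "gauss n" ..
  let ?s = "sqrt (2 * t)"
  let ?v = "\<lambda>z i. ?s * (\<Sum>l<k. z l * u l i)"
  let ?w = "\<lambda>h l. ?s * ip n (u l) h"
  have swap: "ip n (?v z) h = ip k (?w h) z" for z h
    by (simp add: ip_left) (simp add: ip_def[of k] sum_distrib_left mult_ac)
  have v: "- ip n (?v z) (?v z) / 2 = - t * ip k z z" for z
    using assms(2) by (simp only: ip_scale_left ip_scale_right orthonormal_ip_comb[OF u]) simp
  have w: "- ip k (?w h) (?w h) / 2 = - t * proj_ip n k u h h" for h
    using assms(2) by (simp add: ip_scale_left ip_scale_right) (simp add: ip_def[of k] proj_ip_def)
  have [measurable]: "(\<lambda>p. ip n (?v (fst p)) (snd p)) \<in> borel_measurable (gauss k \<Otimes>\<^sub>M gauss n)"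
    by (intro measurable_ip borel_measurable_times borel_measurable_sum borel_measurable_const
        measurable_compose[OF measurable_fst measurable_gauss_component]
        measurable_compose[OF measurable_snd measurable_gauss_component]) auto
  \<comment> \<open>The cosine changes sign, so the exchange of integrals rests on its boundedness
    under a probability measure instead of nonnegativity.\<close>
  have int: "integrable (gauss k \<Otimes>\<^sub>M gauss n) (\<lambda>(z, h). cos (ip n (?v z) h))"
    by (rule P.integrable_const_bound[where B = 1]) (auto simp: case_prod_unfold)
  have [measurable]: "(\<lambda>h. proj_ip n k u h h) \<in> borel_measurable (gauss n)"
    unfolding proj_ip_def by measurable
  have pos: "proj_ip n k u h h \<ge> 0" for h by (simp add: proj_ip_def sum_nonneg)
  have "(LINT h|gauss n. exp (- t * proj_ip n k u h h)) =
      (LINT h|gauss n. LINT z|gauss k. cos (ip n (?v z) h))"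
    by (simp only: swap gauss_cos w)
  also have "\<dots> = (LINT z|gauss k. LINT h|gauss n. cos (ip n (?v z) h))"
    by (rule Fubini_integral[OF int])
  also have "\<dots> = (LINT z|gauss k. exp (- t * ip k z z))"
    by (simp only: gauss_cos v)
  finally have *: "(LINT h|gauss n. exp (- t * proj_ip n k u h h)) = (LINT z|gauss k. exp (- t * ip k z z))" .
  have "(\<integral>\<^sup>+h. ennreal (exp (- t * proj_ip n k u h h)) \<partial>gauss n) = ennreal (LINT h|gauss n. exp (- t * proj_ip n k u h h))"
    using assms(2) pos by (intro nn_integral_eq_integral G.integrable_const_bound[where B = 1]) auto
  also have "\<dots> = (\<integral>\<^sup>+z. ennreal (exp (- t * ip k z z)) \<partial>gauss k)"
    unfolding * using assms(2) ip_self_nonneg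
    by (intro nn_integral_eq_integral[symmetric] K.integrable_const_bound[where B = 1]) auto
  finally show ?thesis .
qed

lemma mgf_orthonormal_le:
  assumes "orthonormal n k u" "\<bar>t\<bar> \<le> 1/4"
  shows "(\<integral>\<^sup>+h. ennreal (exp (t * proj_ip n k u h h)) \<partial>gauss n) \<le> ennreal (exp (real k * (t + 4 * t\<^sup>2)))"
proof -
  have "(\<integral>\<^sup>+h. ennreal (exp (t * proj_ip n k u h h)) \<partial>gauss n) = (\<integral>\<^sup>+z. ennreal (exp (t * ip k z z)) \<partial>gauss k)"
    using mgf_orthonormal_pos[OF assms(1), of t] mgf_orthonormal_neg[OF assms(1), of "- t"]
    by (cases "t \<ge> 0") auto
  also have "\<dots> \<le> ennreal (exp (t + 4 * t\<^sup>2)) ^ k"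
    unfolding nn_integral_gauss_exp_square by (intro power_mono std_normal_exp_square_le assms) auto
  also have "\<dots> = ennreal (exp (real k * (t + 4 * t\<^sup>2)))"
    by (simp add: ennreal_power exp_of_nat_mult)
  finally show ?thesis .
qed

text \<open>Markov's inequality for the exponential. Since \<open>t\<close> may have either sign,
  this covers the upper and the lower tail.\<close>

lemma chernoff_orthonormal:
  assumes u: "orthonormal n k u" and t: "\<bar>t\<bar> \<le> 1/4"
  shows "emeasure (gauss n) {h \<in> space (gauss n). t * proj_ip n k u h h \<ge> a} \<le>
    ennreal (exp (real k * (t + 4 * t\<^sup>2) - a))"
proof -
  have [measurable]: "(\<lambda>h. proj_ip n k u h h) \<in> borel_measurable (gauss n)"
    unfolding proj_ip_def by measurable
  have "emeasure (gauss n) {h \<in> space (gauss n). t * proj_ip n k u h h \<ge> a} =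
      (\<integral>\<^sup>+h. indicator {h \<in> space (gauss n). t * proj_ip n k u h h \<ge> a} h \<partial>gauss n)" by simp
  also have "\<dots> \<le> (\<integral>\<^sup>+h. ennreal (exp (- a)) * ennreal (exp (t * proj_ip n k u h h)) \<partial>gauss n)"
    by (intro nn_integral_mono) (auto simp: indicator_def ennreal_mult[symmetric] exp_add[symmetric])
  also have "\<dots> = ennreal (exp (- a)) * (\<integral>\<^sup>+h. ennreal (exp (t * proj_ip n k u h h)) \<partial>gauss n)"
    by (rule nn_integral_cmult) measurable
  also have "\<dots> \<le> ennreal (exp (- a)) * ennreal (exp (real k * (t + 4 * t\<^sup>2)))"
    by (intro mult_left_mono mgf_orthonormal_le assms) auto
  also have "\<dots> = ennreal (exp (real k * (t + 4 * t\<^sup>2) - a))"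
    by (simp add: ennreal_mult[symmetric] exp_add[symmetric])
  finally show ?thesis .
qed

lemma chi_square_concentration:
  assumes u: "orthonormal n k u" and \<tau>: "0 < \<tau>" "\<tau> \<le> 1"
  shows "emeasure (gauss n) {h \<in> space (gauss n). \<bar>proj_ip n k u h h - real k\<bar> \<ge> \<tau> * real k} \<le>
    ennreal (2 * exp (- real k * \<tau>\<^sup>2 / 16))"
proof -
  let ?A = "\<lambda>t a. {h \<in> space (gauss n). t * proj_ip n k u h h \<ge> a}"
  have [measurable]: "(\<lambda>h. proj_ip n k u h h) \<in> borel_measurable (gauss n)"
    unfolding proj_ip_def by measurable
  \<comment> \<open>A deviation \<open>\<tau> * k\<close> gives the exponent
    \<open>k * (4 * t\<^sup>2 - \<bar>t\<bar> * \<tau>)\<close>. It is least at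
    \<open>\<bar>t\<bar> = \<tau> / 8\<close>, with value
    \<open>- k * \<tau>\<^sup>2 / 16\<close>.\<close>
  have bound: "emeasure (gauss n) (?A t (t * real k + \<tau>\<^sup>2 / 8 * real k)) \<le> ennreal (exp (- real k * \<tau>\<^sup>2 / 16))"
    if "t = \<tau> / 8 \<or> t = - \<tau> / 8" for t
  proof -
    have "t\<^sup>2 = \<tau>\<^sup>2 / 64" using that by (auto simp: power2_eq_square)
    then have "real k * (t + 4 * t\<^sup>2) - (t * real k + \<tau>\<^sup>2 / 8 * real k) = - real k * \<tau>\<^sup>2 / 16"
      by (simp add: algebra_simps)
    then show ?thesis
      using chernoff_orthonormal[OF u, of t "t * real k + \<tau>\<^sup>2 / 8 * real k"] that \<tau> by auto
  qed
  let ?B = "?A (\<tau> / 8) (\<tau> / 8 * real k + \<tau>\<^sup>2 / 8 * real k)"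
  let ?C = "?A (- \<tau> / 8) (- \<tau> / 8 * real k + \<tau>\<^sup>2 / 8 * real k)"
  have "h \<in> ?B \<union> ?C" if h: "h \<in> space (gauss n)" "\<bar>proj_ip n k u h h - real k\<bar> \<ge> \<tau> * real k" for h
  proof (cases "proj_ip n k u h h - real k \<ge> 0")
    case True
    then have "\<tau> / 8 * (\<tau> * real k) \<le> \<tau> / 8 * (proj_ip n k u h h - real k)"
      using h(2) \<tau> by (intro mult_left_mono) auto
    then show ?thesis using h by (simp add: algebra_simps power2_eq_square)
  next
    case False
    then have "\<tau> / 8 * (\<tau> * real k) \<le> \<tau> / 8 * (real k - proj_ip n k u h h)"
      using h(2) \<tau> by (intro mult_left_mono) auto
    then show ?thesis using h by (simp add: algebra_simps power2_eq_square)
  qed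
  then have "emeasure (gauss n) {h \<in> space (gauss n). \<bar>proj_ip n k u h h - real k\<bar> \<ge> \<tau> * real k} \<le>
      emeasure (gauss n) (?B \<union> ?C)"
    by (intro emeasure_mono) auto
  also have "\<dots> \<le> emeasure (gauss n) ?B + emeasure (gauss n) ?C"
    by (rule emeasure_subadditive) measurable
  also have "\<dots> \<le> ennreal (exp (- real k * \<tau>\<^sup>2 / 16)) + ennreal (exp (- real k * \<tau>\<^sup>2 / 16))"
    by (intro add_mono bound) auto
  also have "\<dots> = ennreal (2 * exp (- real k * \<tau>\<^sup>2 / 16))"
    by (simp add: ennreal_plus[symmetric] del: ennreal_plus)
  finally show ?thesis .
qed

text \<open>With the standard basis as orthonormal system, the concentration of projected lengths
  also covers the full length.\<close>

lemma orthonormal_unit: "orthonormal n n (\<lambda>j i. if i = j then 1 else 0)"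
  by (auto simp: orthonormal_def ip_def if_distrib[of "\<lambda>a. a * _"] cong: if_cong)

lemma proj_ip_unit: "proj_ip n n (\<lambda>j i. if i = j then 1 else 0) h h = ip n h h"
  by (simp add: proj_ip_def) (simp add: ip_def if_distrib[of "\<lambda>a. a * _"] cong: if_cong)

lemma orthonormal_gs: "indep n k g \<Longrightarrow> orthonormal n k (gs n g)"
  using is_onb_gs[of n k g] by (simp add: is_onb_def orthonormal_def)

lemma emeasure_distorted_fixed_subspace_le:
  assumes g: "indep n k g" and k: "0 < k" "k \<le> n" and \<eta>: "0 < \<eta>" "\<eta> \<le> 1"
  shows "emeasure (gauss n) {h \<in> space (gauss n). distorted n k \<eta> g h} \<le>
    ennreal (4 * exp (- real k * \<eta>\<^sup>2 / 256))"
proof -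
  \<comment> \<open>Errors of \<open>\<eta> / 4\<close> in both normalised squared lengths put them
    at most \<open>\<eta> / 2\<close> apart, and the full one is at least \<open>1 / 2\<close>, so
    the relative error is at most \<open>\<eta>\<close>. Hence also
    \<open>256 = 16 * 4\<^sup>2\<close>.\<close>
  let ?\<tau> = "\<eta> / 4"
  let ?Y = "\<lambda>h. proj_ip n k (gs n g) h h"
  let ?A = "{h \<in> space (gauss n). \<bar>?Y h - real k\<bar> \<ge> ?\<tau> * real k}"
  let ?B = "{h \<in> space (gauss n). \<bar>ip n h h - real n\<bar> \<ge> ?\<tau> * real n}"
  have [measurable]: "?Y \<in> borel_measurable (gauss n)"
    unfolding proj_ip_def by measurable
  have A: "emeasure (gauss n) ?A \<le> ennreal (2 * exp (- real k * \<eta>\<^sup>2 / 256))"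
    using chi_square_concentration[OF orthonormal_gs[OF g], of ?\<tau>] \<eta> by (simp add: power_divide)
  have "emeasure (gauss n) ?B \<le> ennreal (2 * exp (- real n * \<eta>\<^sup>2 / 256))"
    using chi_square_concentration[OF orthonormal_unit[of n], of ?\<tau>, unfolded proj_ip_unit] \<eta>
    by (simp add: power_divide)
  also have "\<dots> \<le> ennreal (2 * exp (- real k * \<eta>\<^sup>2 / 256))"
    using k by (intro ennreal_leI) (auto intro!: mult_right_mono)
  finally have B: "emeasure (gauss n) ?B \<le> ennreal (2 * exp (- real k * \<eta>\<^sup>2 / 256))" .
  have "\<not> distorted n k \<eta> g h" if Y: "\<bar>?Y h - real k\<bar> < ?\<tau> * real k" and X: "\<bar>ip n h h - real n\<bar> < ?\<tau> * real n" for h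
  proof -
    let ?y = "?Y h / real k" and ?x = "ip n h h / real n"
    have n: "n > 0" using k by simp
    have y: "\<bar>?y - 1\<bar> \<le> ?\<tau>"
    proof -
      have "\<bar>?y - 1\<bar> = \<bar>?Y h - real k\<bar> / real k" using k by (simp add: divide_simps)
      also have "\<dots> \<le> ?\<tau>" using Y k by (simp add: field_simps)
      finally show ?thesis .
    qed
    have x: "\<bar>?x - 1\<bar> \<le> ?\<tau>"
    proof -
      have "\<bar>?x - 1\<bar> = \<bar>ip n h h - real n\<bar> / real n" using n by (simp add: divide_simps)
      also have "\<dots> \<le> ?\<tau>" using X n by (simp add: field_simps)
      finally show ?thesis .
    qed
    have "?x \<ge> 1/2" using abs_le_D2[OF x] \<eta> by linarith
    then have "\<eta> * (1 / 2) \<le> \<eta> * ?x" using \<eta> by (intro mult_left_mono) auto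
    then have "\<bar>?y - ?x\<bar> \<le> \<eta> * ?x" using x y by linarith
    then have "real n * \<bar>?y - ?x\<bar> \<le> real n * (\<eta> * ?x)" by (intro mult_left_mono) auto
    moreover have "real n * \<bar>?y - ?x\<bar> = \<bar>real n * (?y - ?x)\<bar>" by (simp add: abs_mult)
    ultimately have "\<bar>real n * (?y - ?x)\<bar> \<le> \<eta> * ip n h h" using n by simp
    then show ?thesis using n by (simp add: distorted_def right_diff_distrib)
  qed
  then have "{h \<in> space (gauss n). distorted n k \<eta> g h} \<subseteq> ?A \<union> ?B" by (auto simp: not_less[symmetric])
  then have "emeasure (gauss n) {h \<in> space (gauss n). distorted n k \<eta> g h} \<le> emeasure (gauss n) (?A \<union> ?B)"
    by (intro emeasure_mono) auto
  also have "\<dots> \<le> emeasure (gauss n) ?A + emeasure (gauss n) ?B"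
    by (rule emeasure_subadditive) measurable
  also have "\<dots> \<le> ennreal (2 * exp (- real k * \<eta>\<^sup>2 / 256)) + ennreal (2 * exp (- real k * \<eta>\<^sup>2 / 256))"
    by (intro add_mono A B)
  also have "\<dots> = ennreal (4 * exp (- real k * \<eta>\<^sup>2 / 256))"
    by (simp add: ennreal_plus[symmetric] del: ennreal_plus)
  finally show ?thesis .
qed

lemma emeasure_distorted:
  assumes "0 < k" "k \<le> n" "0 < \<eta>" "\<eta> \<le> 1"
  shows "emeasure (gauss_tuple n k) {g \<in> space (gauss_tuple n k). distorted n k \<eta> g x} \<le>
    ennreal (4 * exp (- real k * \<eta>\<^sup>2 / 256))"
  using assms by (intro emeasure_distorted_le emeasure_distorted_fixed_subspace_le) auto

section \<open>Comparison of the integrals\<close>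

lemma gauss_integral_sum_prod:
  fixes N :: nat
  shows "(LINT x|gauss k. (\<Sum>I\<in>{I. I \<subseteq> {1..N} \<and> card I = m}. \<alpha> I * (\<Prod>i\<in>I. ip k (w i) x))) =
    (\<Sum>I\<in>{I. I \<subseteq> {1..N} \<and> card I = m}. \<alpha> I * (LINT x|gauss k. (\<Prod>i\<in>I. ip k (w i) x)))"
proof (subst Bochner_Integration.integral_sum)
  fix I assume "I \<in> {I. I \<subseteq> {1..N} \<and> card I = m}"
  then have "finite I" using finite_subset[of I "{1..N}"] by simp
  then show "integrable (gauss k) (\<lambda>x. \<alpha> I * (\<Prod>i\<in>I. ip k (w i) x))" by simp
qed simp

lemma gauss_int_sum_prod:
  fixes N :: nat
  assumes f: "\<And>x. x \<in> Rn n \<Longrightarrow> f x = (\<Sum>I\<in>{I. I \<subseteq> {1..N} \<and> card I = m}. \<alpha> I * (\<Prod>i\<in>I. ip n (c i) x))"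
  shows "gauss_int n f =
    (\<Sum>I\<in>{I. I \<subseteq> {1..N} \<and> card I = m}. \<alpha> I * (LINT x|gauss n. (\<Prod>i\<in>I. ip n (c i) x)))"
proof -
  have ip: "ip n a (\<lambda>i. if i < n then x i else 0) = ip n a x" for a x
    by (rule ip_cong) auto
  have "f (\<lambda>i. if i < n then x i else 0) =
      (\<Sum>I\<in>{I. I \<subseteq> {1..N} \<and> card I = m}. \<alpha> I * (\<Prod>i\<in>I. ip n (c i) x))" for x
    by (subst f) (simp_all only: ip, simp add: Rn_def)
  then show ?thesis
    by (simp only: gauss_int_def gauss_integral_sum_prod)
qed

text \<open>For an orthonormal \<open>u\<close>, the coordinates in \<open>u\<close> of the
  projection of \<open>x\<close> onto its span. This is how functionals on \<open>L\<close> become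
  functionals on the \<open>k\<close>-dimensional Gaussian space.\<close>

definition proj_coords :: "nat \<Rightarrow> (nat \<Rightarrow> nat \<Rightarrow> real) \<Rightarrow> (nat \<Rightarrow> real) \<Rightarrow> nat \<Rightarrow> real" where
  "proj_coords n u x j = ip n (u j) x"

lemma ip_proj_coords: "ip k (proj_coords n u x) (proj_coords n u y) = proj_ip n k u x y"
  by (simp add: ip_def[of k] proj_coords_def proj_ip_def)

lemma integral_subspace_sum_prod:
  fixes N :: nat
  assumes f: "\<And>x. x \<in> Rn n \<Longrightarrow> f x = (\<Sum>I\<in>{I. I \<subseteq> {1..N} \<and> card I = m}. \<alpha> I * (\<Prod>i\<in>I. ip n (c i) x))"
  shows "(LINT z|gauss k. f (\<lambda>i. if i < n then (\<Sum>j<k. z j * u j i) else 0)) =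
    (\<Sum>I\<in>{I. I \<subseteq> {1..N} \<and> card I = m}. \<alpha> I * (LINT z|gauss k. (\<Prod>i\<in>I. ip k (proj_coords n u (c i)) z)))"
proof -
  have "ip n a (\<lambda>i. if i < n then (\<Sum>j<k. z j * u j i) else 0) = ip n a (\<lambda>i. \<Sum>j<k. z j * u j i)" for a z
    by (rule ip_cong) auto
  also have "ip n a (\<lambda>i. \<Sum>j<k. z j * u j i) = ip k (proj_coords n u a) z" for a z
    by (simp add: ip_sum_right ip_scale_right)
      (simp add: ip_def[of k] proj_coords_def ip_commute[of n a] mult.commute)
  finally have ip: "ip n a (\<lambda>i. if i < n then (\<Sum>j<k. z j * u j i) else 0) = ip k (proj_coords n u a) z" for a z .
  have "f (\<lambda>i. if i < n then (\<Sum>j<k. z j * u j i) else 0) =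
      (\<Sum>I\<in>{I. I \<subseteq> {1..N} \<and> card I = m}. \<alpha> I * (\<Prod>i\<in>I. ip k (proj_coords n u (c i)) z))" for z
    by (subst f) (simp_all only: ip, simp add: Rn_def)
  then show ?thesis
    by (simp only: gauss_integral_sum_prod)
qed

text \<open>The integral over the span of an independent \<open>g\<close>, computed in the
  Gram--Schmidt basis so that it depends measurably on \<open>g\<close>.\<close>

definition subspace_sum ::
  "nat \<Rightarrow> nat \<Rightarrow> nat \<Rightarrow> nat \<Rightarrow> (nat set \<Rightarrow> real) \<Rightarrow> (nat \<Rightarrow> nat \<Rightarrow> real) \<Rightarrow> (nat \<Rightarrow> nat \<Rightarrow> real) \<Rightarrow> real"
where
  "subspace_sum n k N m \<alpha> c g = (\<Sum>I\<in>{I. I \<subseteq> {1..N} \<and> card I = m}.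
     \<alpha> I * (LINT z|gauss k. (\<Prod>i\<in>I. ip k (proj_coords n (gs n g) (c i)) z)))"

text \<open>The basis picked by \<open>SOME\<close> and the Gram--Schmidt basis yield the same Gram
  matrix of projections, and Wick's formula sees nothing else.\<close>

lemma gauss_int_sub_span:
  fixes N :: nat
  assumes f: "\<And>x. x \<in> Rn n \<Longrightarrow> f x = (\<Sum>I\<in>{I. I \<subseteq> {1..N} \<and> card I = m}. \<alpha> I * (\<Prod>i\<in>I. ip n (c i) x))"
    and g: "indep n k g"
  shows "gauss_int_sub n k (span_n n k g) f = subspace_sum n k N m \<alpha> c g"
proof -
  define u where "u = (SOME u. is_onb n k (span_n n k g) u)"
  have u: "is_onb n k (span_n n k g) u"
    unfolding u_def using is_onb_gs[OF g] by (rule someI[of "is_onb n k (span_n n k g)"])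
  have "gauss_int_sub n k (span_n n k g) f =
      (\<Sum>I\<in>{I. I \<subseteq> {1..N} \<and> card I = m}. \<alpha> I * (LINT z|gauss k. (\<Prod>i\<in>I. ip k (proj_coords n u (c i)) z)))"
    unfolding gauss_int_sub_def u_def[symmetric] Let_def by (rule integral_subspace_sum_prod[OF f])
  also have "\<dots> = subspace_sum n k N m \<alpha> c g"
    unfolding subspace_sum_def
  proof (intro sum.cong refl arg_cong2[where f = "(*)"])
    fix I assume "I \<in> {I. I \<subseteq> {1..N} \<and> card I = m}"
    then have "finite I" using finite_subset[of I "{1..N}"] by simp
    then show "(LINT z|gauss k. (\<Prod>i\<in>I. ip k (proj_coords n u (c i)) z)) =
        (LINT z|gauss k. (\<Prod>i\<in>I. ip k (proj_coords n (gs n g) (c i)) z))"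
      by (rule wick_gram_cong) (simp only: ip_proj_coords proj_ip_onb[OF u])
  qed
  finally show ?thesis .
qed

lemma measurable_subspace_sum [measurable]: "subspace_sum n k N m \<alpha> c \<in> borel_measurable (gauss_tuple n k)"
proof -
  interpret K: prob_space "gauss k" by (rule prob_space_gauss)
  let ?MK = "gauss_tuple n k \<Otimes>\<^sub>M gauss k"
  have gs: "(\<lambda>p. gs n (fst p) j l) \<in> borel_measurable ?MK" if "j < k" "l < n" for j l
    using that by (intro measurable_gs measurable_compose[OF measurable_fst measurable_gauss_tuple_component]) auto
  have coords: "(\<lambda>p. proj_coords n (gs n (fst p)) x j) \<in> borel_measurable ?MK" if "j < k" for x j
    unfolding proj_coords_def using that by (intro measurable_ip gs measurable_const) auto
  have ip: "(\<lambda>p. ip k (proj_coords n (gs n (fst p)) x) (snd p)) \<in> borel_measurable ?MK" for x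
    by (intro measurable_ip coords measurable_compose[OF measurable_snd measurable_gauss_component])
  have "(\<lambda>g. LINT z|gauss k. (\<Prod>i\<in>I. ip k (proj_coords n (gs n g) (c i)) z)) \<in> borel_measurable (gauss_tuple n k)" for I
    by (rule K.borel_measurable_lebesgue_integral, unfold case_prod_unfold, intro borel_measurable_prod ip)
  then have "(\<lambda>g. subspace_sum n k N m \<alpha> c g) \<in> borel_measurable (gauss_tuple n k)"
    unfolding subspace_sum_def by (intro borel_measurable_sum borel_measurable_times borel_measurable_const)
  then show ?thesis .
qed

lemma measurable_indep [measurable]: "Measurable.pred (gauss_tuple n k) (indep n k)"
proof -
  have "Measurable.pred (gauss_tuple n k) (\<lambda>g. vnorm n (gres n g j) \<noteq> 0)" if "j < k" for j
  proof -
    have "(\<lambda>g. vnorm n (gres n g j)) \<in> borel_measurable (gauss_tuple n k)"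
      unfolding vnorm_def using that
      by (intro measurable_compose[OF _ borel_measurable_sqrt] measurable_ip measurable_gs) auto
    from measurable_compose[OF this, of "\<lambda>r. r \<noteq> 0"] show ?thesis by simp
  qed
  then have "Measurable.pred (gauss_tuple n k) (\<lambda>g. \<forall>j. j < k \<longrightarrow> vnorm n (gres n g j) \<noteq> 0)"
    by (intro pred_intros_countable pred_intros_imp')
  then show ?thesis unfolding indep_def[abs_def] .
qed

text \<open>On a linearly dependent family the choice of a basis in \<open>gauss_int_sub\<close> ranges over an empty set,
  so that its value does not depend on the family.\<close>

lemma measurable_gauss_int_sub:
  fixes N :: nat
  assumes f: "\<And>x. x \<in> Rn n \<Longrightarrow> f x = (\<Sum>I\<in>{I. I \<subseteq> {1..N} \<and> card I = m}. \<alpha> I * (\<Prod>i\<in>I. ip n (c i) x))"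
  shows "(\<lambda>g. gauss_int_sub n k (span_n n k g) f) \<in> borel_measurable (gauss_tuple n k)"
proof -
  define C where "C = (let u = (SOME u :: nat \<Rightarrow> nat \<Rightarrow> real. False)
      in LINT z|gauss k. f (\<lambda>i. if i < n then (\<Sum>j<k. z j * u j i) else 0))"
  have "gauss_int_sub n k (span_n n k g) f = (if indep n k g then subspace_sum n k N m \<alpha> c g else C)" for g
  proof (cases "indep n k g")
    case False
    then have "is_onb n k (span_n n k g) = (\<lambda>_. False)"
      using is_onb_imp_indep by blast
    then show ?thesis using False by (simp add: gauss_int_sub_def C_def)
  qed (simp add: gauss_int_sub_span[OF f])
  then show ?thesis by simp
qed

text \<open>Nonnegative coefficients allow a comparison term by term, and each term is governed by
  its Gram matrix. The ratio \<open>r\<close> is \<open>k / n\<close> in the application.\<close>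

lemma subspace_sum_bounds:
  fixes n N :: nat
  assumes \<alpha>: "\<And>I. I \<subseteq> {1..N} \<Longrightarrow> card I = m \<Longrightarrow> \<alpha> I \<ge> 0"
    and \<epsilon>: "0 < \<epsilon>" "\<epsilon> < 1" and r: "r > 0"
    and pos: "\<And>i j. i \<in> {1..N} \<Longrightarrow> j \<in> {1..N} \<Longrightarrow> ip n (c i) (c j) \<ge> 0"
    and lower: "\<And>i j. i \<in> {1..N} \<Longrightarrow> j \<in> {1..N} \<Longrightarrow>
      (1 - \<epsilon>) * (r * ip n (c i) (c j)) \<le> proj_ip n k (gs n g) (c i) (c j)"
    and upper: "\<And>i j. i \<in> {1..N} \<Longrightarrow> j \<in> {1..N} \<Longrightarrow>
      (1 - \<epsilon>) * proj_ip n k (gs n g) (c i) (c j) \<le> r * ip n (c i) (c j)"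
  defines "S \<equiv> (\<Sum>I\<in>{I. I \<subseteq> {1..N} \<and> card I = m}. \<alpha> I * (LINT x|gauss n. (\<Prod>i\<in>I. ip n (c i) x)))"
  shows "(1 - \<epsilon>) powr (real m / 2) * subspace_sum n k N m \<alpha> c g \<le> r powr (real m / 2) * S"
    and "r powr (real m / 2) * S \<le> (1 - \<epsilon>) powr (- (real m / 2)) * subspace_sum n k N m \<alpha> c g"
proof -
  let ?E = "\<lambda>I. LINT x|gauss n. (\<Prod>i\<in>I. ip n (c i) x)"
  let ?F = "\<lambda>I. LINT z|gauss k. (\<Prod>i\<in>I. ip k (proj_coords n (gs n g) (c i)) z)"
  have ppos: "proj_ip n k (gs n g) (c i) (c j) \<ge> 0" if "i \<in> {1..N}" "j \<in> {1..N}" for i j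
  proof -
    have "0 \<le> (1 - \<epsilon>) * (r * ip n (c i) (c j))"
      using \<epsilon> r pos[OF that] by simp
    then show ?thesis using lower[OF that] by (rule order_trans)
  qed
  have bounds: "(1 - \<epsilon>) powr (real m / 2) * ?F I \<le> r powr (real m / 2) * ?E I"
    "r powr (real m / 2) * ?E I \<le> (1 - \<epsilon>) powr (- (real m / 2)) * ?F I"
    if I: "I \<subseteq> {1..N}" "card I = m" for I
  proof -
    have fin: "finite I" using I(1) by (rule finite_subset) simp
    have mem: "i \<in> {1..N}" if "i \<in> I" for i using that I by auto
    have "(1 - \<epsilon>) powr (real m / 2) * ?F I \<le> r powr (real m / 2) * ?E I \<and>
        r powr (real m / 2) * ?E I \<le> (1 - \<epsilon>) powr (- (real m / 2)) * ?F I"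
    \<comment> \<open>For odd \<open>m\<close> both integrals vanish. For even \<open>m\<close> the
      real exponent \<open>m / 2\<close> is the natural number \<open>card I div 2\<close> of
      \<open>wick_mono\<close>.\<close>
    proof (cases "even m")
      case False
      then show ?thesis using wick_odd[OF fin] I by simp
    next
      case True
      have pow: "a powr (real m / 2) = a ^ (card I div 2)" if "a > 0" for a
      proof -
        have "real m / 2 = real (card I div 2)" using True I by (simp add: real_of_nat_div)
        then show ?thesis using that by (simp add: powr_realpow)
      qed
      have pow': "(1 - \<epsilon>) powr (- (real m / 2)) = (1 / (1 - \<epsilon>)) ^ (card I div 2)"
        using pow[of "1 - \<epsilon>"] \<epsilon> by (simp only: powr_minus power_one_over inverse_eq_divide)
      have even: "even (card I)" using True I by simp
      have pos_I: "ip n (c i) (c j) \<ge> 0" if "i \<in> I" "j \<in> I" for i j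
        by (intro pos mem that)
      have ppos_I: "ip k (proj_coords n (gs n g) (c i)) (proj_coords n (gs n g) (c j)) \<ge> 0"
        if "i \<in> I" "j \<in> I" for i j
        unfolding ip_proj_coords by (intro ppos mem that)
      have "(1 - \<epsilon>) ^ (card I div 2) * ?F I \<le> r ^ (card I div 2) * ?E I"
      proof (rule wick_mono[OF fin even _ _ ppos_I pos_I])
        fix i j assume ij: "i \<in> I" "j \<in> I"
        show "(1 - \<epsilon>) * ip k (proj_coords n (gs n g) (c i)) (proj_coords n (gs n g) (c j)) \<le> r * ip n (c i) (c j)"
          unfolding ip_proj_coords by (intro upper mem ij)
      qed (use \<epsilon> r in simp_all)
      moreover have "r ^ (card I div 2) * ?E I \<le> (1 / (1 - \<epsilon>)) ^ (card I div 2) * ?F I"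
      proof (rule wick_mono[OF fin even _ _ pos_I ppos_I])
        fix i j assume ij: "i \<in> I" "j \<in> I"
        have "(1 - \<epsilon>) * (r * ip n (c i) (c j)) \<le> proj_ip n k (gs n g) (c i) (c j)"
          by (intro lower mem ij)
        then show "r * ip n (c i) (c j) \<le> 1 / (1 - \<epsilon>) * ip k (proj_coords n (gs n g) (c i)) (proj_coords n (gs n g) (c j))"
          unfolding ip_proj_coords using \<epsilon> by (simp add: pos_le_divide_eq mult.commute)
      qed (use \<epsilon> r in simp_all)
      ultimately show ?thesis
        using pow[of r] pow[of "1 - \<epsilon>"] pow' r \<epsilon> by simp
    qed
    then show "(1 - \<epsilon>) powr (real m / 2) * ?F I \<le> r powr (real m / 2) * ?E I"
      "r powr (real m / 2) * ?E I \<le> (1 - \<epsilon>) powr (- (real m / 2)) * ?F I" by auto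
  qed
  have scale: "p * (\<alpha> I * F) \<le> q * (\<alpha> I * E)"
    if "I \<in> {I. I \<subseteq> {1..N} \<and> card I = m}" "p * F \<le> q * E" for I p q E F
  proof -
    have "\<alpha> I * (p * F) \<le> \<alpha> I * (q * E)"
      using that \<alpha>[of I] by (intro mult_left_mono) auto
    then show ?thesis by (simp only: mult.left_commute)
  qed
  show "(1 - \<epsilon>) powr (real m / 2) * subspace_sum n k N m \<alpha> c g \<le> r powr (real m / 2) * S"
    unfolding subspace_sum_def S_def sum_distrib_left by (intro sum_mono scale bounds) auto
  show "r powr (real m / 2) * S \<le> (1 - \<epsilon>) powr (- (real m / 2)) * subspace_sum n k N m \<alpha> c g"
    unfolding subspace_sum_def S_def sum_distrib_left by (intro sum_mono scale bounds) auto
qed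

text \<open>Polarisation turns control of the lengths of \<open>x \<plusminus> y\<close> into control of inner products.\<close>

lemma proj_ip_normalized_bounds:
  fixes x y :: "nat \<Rightarrow> real" and n :: nat
  defines "v \<equiv> \<lambda>\<sigma> i. x i / vnorm n x + \<sigma> * (y i / vnorm n y)"
  assumes nz: "vnorm n x > 0" "vnorm n y > 0"
    and good: "\<not> distorted n k (\<epsilon> * \<delta>) g (v 1)" "\<not> distorted n k (\<epsilon> * \<delta>) g (v (-1))"
    and \<delta>: "\<delta> > 0" "ip n x y / (vnorm n x * vnorm n y) \<ge> \<delta>"
    and \<epsilon>: "0 < \<epsilon>" "\<epsilon> < 1" and kn: "0 < k" "0 < n"
  shows "(1 - \<epsilon>) * (real k / real n * ip n x y) \<le> proj_ip n k (gs n g) x y"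
    and "(1 - \<epsilon>) * proj_ip n k (gs n g) x y \<le> real k / real n * ip n x y"
proof -
  define a where "a = (\<lambda>i. x i / vnorm n x)"
  define b where "b = (\<lambda>i. y i / vnorm n y)"
  let ?P = "proj_ip n k (gs n g)"
  let ?q = "real n / real k"
  have v: "v \<sigma> = (\<lambda>i. a i + \<sigma> * b i)" for \<sigma>
    by (simp add: v_def a_def b_def)
  have P_v: "?P (v \<sigma>) (v \<sigma>) = ?P a a + 2 * \<sigma> * ?P a b + \<sigma>\<^sup>2 * ?P b b" for \<sigma>
    by (simp add: v proj_ip_def ip_add_right ip_scale_right sum_distrib_left sum.distrib[symmetric]
        power2_eq_square algebra_simps)
  have aa: "ip n a a = 1" "ip n b b = 1"
    using nz by (simp_all add: a_def b_def ip_divide_left ip_divide_right vnorm_square[symmetric] power2_eq_square)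
  have I_v: "ip n (v \<sigma>) (v \<sigma>) = 1 + 2 * \<sigma> * ip n a b + \<sigma>\<^sup>2" for \<sigma>
    by (simp add: v ip_add_right ip_scale_right ip_add_left ip_scale_left aa ip_commute[of n b a]
        power2_eq_square algebra_simps)
  have 1: "\<bar>?q * ?P (v 1) (v 1) - ip n (v 1) (v 1)\<bar> \<le> \<epsilon> * \<delta> * ip n (v 1) (v 1)"
    and 2: "\<bar>?q * ?P (v (-1)) (v (-1)) - ip n (v (-1)) (v (-1))\<bar> \<le> \<epsilon> * \<delta> * ip n (v (-1)) (v (-1))"
    using good by (simp_all add: distorted_def)
  have polar: "\<bar>z\<bar> \<le> e" if "4 * z = p - q" "s + t = 4 * e" "\<bar>p\<bar> \<le> s" "\<bar>q\<bar> \<le> t"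
    for e p q s t z :: real
    using that by linarith
  have "4 * (?q * ?P a b - ip n a b) =
      (?q * ?P (v 1) (v 1) - ip n (v 1) (v 1)) - (?q * ?P (v (-1)) (v (-1)) - ip n (v (-1)) (v (-1)))"
    by (simp add: P_v I_v algebra_simps)
  \<comment> \<open>The parallelogram law for unit vectors: the squared lengths of sum and
    difference add up to 4, the factor that polarisation divides out.\<close>
  moreover have "\<epsilon> * \<delta> * ip n (v 1) (v 1) + \<epsilon> * \<delta> * ip n (v (-1)) (v (-1)) = 4 * (\<epsilon> * \<delta>)"
    by (simp add: I_v algebra_simps)
  ultimately have err: "\<bar>?q * ?P a b - ip n a b\<bar> \<le> \<epsilon> * \<delta>"
    by (rule polar[OF _ _ 1 2])
  have ab: "ip n a b = ip n x y / (vnorm n x * vnorm n y)"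
    by (simp add: a_def b_def ip_divide_left ip_divide_right)
  then have "\<delta> \<le> ip n a b" using \<delta>(2) by simp
  then have ab_pos: "ip n a b > 0" and "\<epsilon> * \<delta> \<le> \<epsilon> * ip n a b"
    using \<delta>(1) \<epsilon>(1) by (simp_all add: mult_left_mono)
  then have lo: "(1 - \<epsilon>) * ip n a b \<le> ?q * ?P a b" and hi: "?q * ?P a b \<le> (1 + \<epsilon>) * ip n a b"
    using abs_le_D1[OF err] abs_le_D2[OF err] unfolding left_diff_distrib distrib_right mult_1 by linarith+
  \<comment> \<open>As \<open>1 - \<epsilon>\<^sup>2 \<le> 1\<close>, an upper factor
    \<open>1 + \<epsilon>\<close> is at most \<open>1 / (1 - \<epsilon>)\<close>, the form needed
    for the theorem.\<close>
  have "(1 - \<epsilon>) * (?q * ?P a b) \<le> (1 - \<epsilon>) * ((1 + \<epsilon>) * ip n a b)"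
    using hi \<epsilon> by (intro mult_left_mono) auto
  also have "\<dots> = ip n a b - \<epsilon>\<^sup>2 * ip n a b" by (simp add: algebra_simps power2_eq_square)
  also have "\<dots> \<le> ip n a b" using ab_pos by simp
  finally have hi': "(1 - \<epsilon>) * (?q * ?P a b) \<le> ip n a b" .
  have x: "ip n x y = vnorm n x * vnorm n y * ip n a b"
    using nz ab by simp
  have P: "?P x y = vnorm n x * vnorm n y * ?P a b"
    using nz by (simp add: proj_ip_def a_def b_def ip_divide_right sum_distrib_left)
  let ?c = "real k / real n * (vnorm n x * vnorm n y)"
  have c: "?c \<ge> 0" using nz by simp
  have "?c * ((1 - \<epsilon>) * ip n a b) \<le> ?c * (?q * ?P a b)" by (rule mult_left_mono[OF lo c])
  then show "(1 - \<epsilon>) * (real k / real n * ip n x y) \<le> ?P x y"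
    using kn by (simp add: x P mult_ac)
  have "?c * ((1 - \<epsilon>) * (?q * ?P a b)) \<le> ?c * ip n a b" by (rule mult_left_mono[OF hi' c])
  then show "(1 - \<epsilon>) * ?P x y \<le> real k / real n * ip n x y"
    using kn by (simp add: x P mult_ac)
qed

text \<open>The origin of \<open>1280 = 5 * 256\<close>: each of the \<open>2 * N\<^sup>2\<close>
  failure probabilities becomes at most \<open>4 / (N + 2) ^ 5\<close>, so their total is at most
  \<open>8 / (N + 2) ^ 3 \<le> 8 / 27\<close>.\<close>

lemma failure_bound:
  assumes "0 < N" "real k \<ge> 1280 * ln (real N + 2) / (\<epsilon>\<^sup>2 * \<delta>\<^sup>2)" "0 < \<epsilon>" "0 < \<delta>"
  shows "2 * (real N)\<^sup>2 * (4 * exp (- real k * (\<epsilon> * \<delta>)\<^sup>2 / 256)) \<le> 1 / 3"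
proof -
  let ?x = "real N + 2"
  have "1280 * ln ?x \<le> real k * (\<epsilon> * \<delta>)\<^sup>2"
    using assms by (simp add: power_mult_distrib field_simps)
  then have "exp (- real k * (\<epsilon> * \<delta>)\<^sup>2 / 256) \<le> exp (- (5 * ln ?x))" by simp
  also have "\<dots> = 1 / ?x ^ 5"
    using assms(1) exp_of_nat_mult[of 5 "ln ?x"] by (simp add: exp_minus inverse_eq_divide)
  finally have "2 * (real N)\<^sup>2 * (4 * exp (- real k * (\<epsilon> * \<delta>)\<^sup>2 / 256)) \<le> 2 * (real N)\<^sup>2 * (4 * (1 / ?x ^ 5))"
    by (intro mult_left_mono) auto
  also have "\<dots> \<le> 2 * ?x\<^sup>2 * (4 * (1 / ?x ^ 5))"
    by (intro mult_right_mono mult_left_mono power_mono) auto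
  also have "\<dots> = 8 / ?x ^ 3" by (simp add: divide_simps eval_nat_numeral)
  also have "\<dots> \<le> 8 / 3 ^ 3" using assms(1) by (intro divide_left_mono power_mono) auto
  finally show ?thesis by simp
qed

theorem theorem1p3:
  shows "\<exists>\<gamma>::real. \<gamma> > 0 \<and>
    (\<forall>(\<delta>::real) (N::nat) (n::nat) (m::nat) (f :: (nat \<Rightarrow> real) \<Rightarrow> real) (\<epsilon>::real) (k::nat).
       0 < \<delta> \<and> \<delta> \<le> 1 \<and> 0 < N \<and> focused n \<delta> N m f \<and> 0 < \<epsilon> \<and> \<epsilon> < 1 \<and>
       0 < k \<and> k \<le> n \<and> real k \<ge> \<gamma> * ln (real N + 2) / (\<epsilon>\<^sup>2 * \<delta>\<^sup>2) \<longrightarrow>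
       haar_prob n k (\<lambda>L.
          (1 - \<epsilon>) powr (real m / 2) * gauss_int_sub n k L f
            \<le> (real k / real n) powr (real m / 2) * gauss_int n f \<and>
          (real k / real n) powr (real m / 2) * gauss_int n f
            \<le> (1 - \<epsilon>) powr (- (real m / 2)) * gauss_int_sub n k L f) \<ge> 2 / 3)"
proof (intro exI[of _ 1280] conjI allI impI)
  fix \<delta> \<epsilon> :: real and N n m k :: nat and f :: "(nat \<Rightarrow> real) \<Rightarrow> real"
  assume "0 < \<delta> \<and> \<delta> \<le> 1 \<and> 0 < N \<and> focused n \<delta> N m f \<and> 0 < \<epsilon> \<and> \<epsilon> < 1 \<and>
       0 < k \<and> k \<le> n \<and> real k \<ge> 1280 * ln (real N + 2) / (\<epsilon>\<^sup>2 * \<delta>\<^sup>2)"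
  then have \<delta>: "0 < \<delta>" "\<delta> \<le> 1" and N: "0 < N" and foc: "focused n \<delta> N m f"
    and \<epsilon>: "0 < \<epsilon>" "\<epsilon> < 1" and k: "0 < k" "k \<le> n"
    and large: "real k \<ge> 1280 * ln (real N + 2) / (\<epsilon>\<^sup>2 * \<delta>\<^sup>2)" by blast+
  obtain c \<alpha> where
    cos: "\<forall>i\<in>{1..N}. \<forall>j\<in>{1..N}. ip n (c i) (c j) / (vnorm n (c i) * vnorm n (c j)) \<ge> \<delta>"
    and \<alpha>: "\<forall>I. I \<subseteq> {1..N} \<and> card I = m \<longrightarrow> \<alpha> I \<ge> 0"
    and f: "\<forall>x\<in>Rn n. f x = (\<Sum>I\<in>{I. I \<subseteq> {1..N} \<and> card I = m}. \<alpha> I * (\<Prod>i\<in>I. ip n (c i) x))"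
    using foc unfolding focused_def by blast
  note cos = cos[rule_format] and \<alpha> = \<alpha>[rule_format, OF conjI] and f = f[rule_format]
  let ?M = "gauss_tuple n k"
  interpret M: prob_space ?M by (rule prob_space_gauss_tuple)
  let ?P = "\<lambda>L. (1 - \<epsilon>) powr (real m / 2) * gauss_int_sub n k L f
            \<le> (real k / real n) powr (real m / 2) * gauss_int n f \<and>
          (real k / real n) powr (real m / 2) * gauss_int n f
            \<le> (1 - \<epsilon>) powr (- (real m / 2)) * gauss_int_sub n k L f"
  let ?E = "{g \<in> space ?M. ?P (span_n n k g)}"
  let ?v = "\<lambda>(i, j, \<sigma>) l. c i l / vnorm n (c i) + \<sigma> * (c j l / vnorm n (c j))"
  \<comment> \<open>All ordered pairs with both signs. On the diagonal the difference is the zero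
    vector, which is never distorted.\<close>
  let ?T = "{1..N} \<times> {1..N} \<times> {1, - 1 :: real}"
  let ?B = "\<lambda>t. {g \<in> space ?M. distorted n k (\<epsilon> * \<delta>) g (?v t)}"
  let ?D = "{g \<in> space ?M. \<not> indep n k g}"
  let ?p = "4 * exp (- real k * (\<epsilon> * \<delta>)\<^sup>2 / 256)"
  \<comment> \<open>\<open>measure\<close> is 0 on nonmeasurable sets, so a lower bound for
    \<open>haar_prob\<close> requires the event to be measurable.\<close>
  have [measurable]: "(\<lambda>g. gauss_int_sub n k (span_n n k g) f) \<in> borel_measurable ?M"
    by (rule measurable_gauss_int_sub[OF f])
  have E: "?E \<in> sets ?M" by measurable
  have D: "?D \<in> sets ?M" by measurable
  have B: "?B t \<in> sets ?M" for t by measurable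
  have norm: "vnorm n (c i) > 0" if i: "i \<in> {1..N}" for i
  proof -
    \<comment> \<open>Taking \<open>j = i\<close>: with norm 0 the quotient would be 0 by the
      division convention, hence below \<open>\<delta>\<close>.\<close>
    have "vnorm n (c i) \<noteq> 0"
      using cos[OF i i] \<delta> by auto
    then show ?thesis by (simp add: vnorm_def ip_self_nonneg less_le)
  qed
  have good: "g \<in> ?E" if g: "g \<in> space ?M" "g \<notin> ?D" "\<And>t. t \<in> ?T \<Longrightarrow> g \<notin> ?B t" for g
  proof -
    have ind: "indep n k g" using g by simp
    have nb: "\<not> distorted n k (\<epsilon> * \<delta>) g (\<lambda>l. c i l / vnorm n (c i) + \<sigma> * (c j l / vnorm n (c j)))"
      if "i \<in> {1..N}" "j \<in> {1..N}" "\<sigma> \<in> {1, - 1}" for i j \<sigma>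
      using g(1) g(3)[of "(i, j, \<sigma>)"] that by simp
    have n: "0 < n" using k by simp
    note bounds = proj_ip_normalized_bounds[OF norm norm nb nb \<delta>(1) cos \<epsilon> k(1) n]
    have pos: "ip n (c i) (c j) \<ge> 0" if "i \<in> {1..N}" "j \<in> {1..N}" for i j
    proof -
      have "0 \<le> ip n (c i) (c j) / (vnorm n (c i) * vnorm n (c j))"
        using cos[OF that] \<delta>(1) by linarith
      then show ?thesis
        using pos_le_divide_eq[OF mult_pos_pos[OF norm[OF that(1)] norm[OF that(2)]]] by simp
    qed
    have r: "real k / real n > 0" using k by simp
    show ?thesis
      using subspace_sum_bounds[where \<alpha> = \<alpha>, OF \<alpha> \<epsilon> r pos bounds(1) bounds(2)] g(1)
      by (simp add: gauss_int_sub_span[OF f ind] gauss_int_sum_prod[OF f])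
  qed
  \<comment> \<open>The union bound: apart from the null set of dependent families, a violated
    inequality forces one of the test vectors to be distorted.\<close>
  have "space ?M - ?E \<subseteq> ?D \<union> (\<Union>t\<in>?T. ?B t)"
  proof (rule subsetI, rule ccontr)
    fix g assume g: "g \<in> space ?M - ?E" and "g \<notin> ?D \<union> (\<Union>t\<in>?T. ?B t)"
    then have 1: "g \<notin> ?D" and 2: "\<And>t. t \<in> ?T \<Longrightarrow> g \<notin> ?B t"
      unfolding Un_iff UN_iff by blast+
    have "g \<in> space ?M" using g by (simp only: Diff_iff)
    then have "g \<in> ?E" by (rule good[OF _ 1]) (rule 2)
    then show False by (rule DiffD2[OF g])
  qed
  then have "emeasure ?M (space ?M - ?E) \<le> emeasure ?M (?D \<union> (\<Union>t\<in>?T. ?B t))"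
    by (rule emeasure_mono) (intro sets.Un D sets.finite_UN B, simp)
  also have "\<dots> \<le> emeasure ?M ?D + emeasure ?M (\<Union>t\<in>?T. ?B t)"
    by (intro emeasure_subadditive D sets.finite_UN B) simp
  also have "emeasure ?M ?D = 0"
    using AE_indep[OF k(2)] D by (subst (asm) AE_iff_measurable[OF D]) auto
  also have "0 + emeasure ?M (\<Union>t\<in>?T. ?B t) \<le> (\<Sum>t\<in>?T. emeasure ?M (?B t))"
    unfolding add_0 by (intro emeasure_subadditive_finite image_subsetI B) simp
  also have "\<dots> \<le> (\<Sum>t\<in>?T. ennreal ?p)"
    using k \<epsilon> \<delta> by (intro sum_mono emeasure_distorted) (auto intro: mult_le_one)
  also have "\<dots> = ennreal (2 * (real N)\<^sup>2 * ?p)"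
    by (simp add: ennreal_of_nat_eq_real_of_nat ennreal_mult[symmetric] power2_eq_square card_insert_if mult_ac)
  also have "\<dots> \<le> ennreal (1 / 3)"
    by (intro ennreal_leI failure_bound N large \<epsilon> \<delta>)
  finally have "measure ?M (space ?M - ?E) \<le> 1 / 3"
    by (simp add: M.emeasure_eq_measure)
  then have "measure ?M ?E \<ge> 2 / 3"
    using M.prob_compl[OF E] by simp
  then show "haar_prob n k ?P \<ge> 2 / 3" by (simp add: haar_prob_def)
qed simp

end
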